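(* Let $(R,\mathfrak m)$ be a Noetherian local ring, and let $\hat R$ be its $\mathfrak m$-adic completion. Then the following are equivalent: (1) The completion map $R\to\hat R$ is Ohm-Rush. (2) The completion map $R\to\hat R$ is Gaussian. (3) For any $g\in\hat R$, there is some $r\in R$ such that $g\hat R=r\hat R$; that is, every principal ideal of $\hat R$ is extended from a principal ideal of $R$. (4) Every ideal of $\hat R$ is extended from $R$.
   Context: All rings are commutative with identity. For a ring $R$, an $R$-module $M$ and $f\in M$, the (Ohm-Rush) content of $f$ is the ideal $c(f):=\bigcap\{I\subseteq R \text{ ideal} \mid f\in IM\}$ of $R$. An $R$-module $M$ is Ohm-Rush if $f\in c(f)M$ for all $f\in M$. A ring homomorphism $R\to S$ is Ohm-Rush (equivalently, $S$ is an Ohm-Rush $R$-algebra) if $S$ is Ohm-Rush as an $R$-module. An Ohm-Rush algebra $R\to S$ is Gaussian if $S$ is faithfully flat over $R$ and $c(fg)=c(f)c(g)$ for all $f,g\in S$. An ideal $J$ of $S$ is extended from $R$ if $J=IS$ for some ideal $I$ of $R$. *)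

theory Defs
  imports "HOL-Algebra.Algebra"
begin

section \<open>Noetherian local rings and their completions\<close>

definition noetherian_local_ring :: "('a, 'r) ring_scheme \<Rightarrow> 'a set \<Rightarrow> bool"
  where "noetherian_local_ring R \<mm> \<longleftrightarrow>
    cring R \<and> noetherian_ring R \<and> maximalideal \<mm> R \<and> (\<forall>I. maximalideal I R \<longrightarrow> I = \<mm>)"

abbreviation ideal_power :: "('a, 'r) ring_scheme \<Rightarrow> 'a set \<Rightarrow> nat \<Rightarrow> 'a set"
  where "ideal_power R I n \<equiv> I [^]\<^bsub>ideals_set R\<^esub> n"

text \<open>
  The inverse limit of the rings \<open>R/\<mm>\<^sup>n\<close>. The elements of \<open>R/\<mm>\<^sup>n\<close> are cosets, and the
  transition map sends a coset of \<open>\<mm>\<^bsup>n+1\<^esup>\<close> to the unique coset of \<open>\<mm>\<^sup>n\<close> containing it; hence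
  the coherence condition is an inclusion. (The factor for \<open>n = 0\<close> is the zero ring.)
\<close>
definition completion :: "('a, 'r) ring_scheme \<Rightarrow> 'a set \<Rightarrow> (nat \<Rightarrow> 'a set) ring"
  where "completion R \<mm> =
    \<lparr>carrier = {x. (\<forall>n. x n \<in> carrier (R Quot ideal_power R \<mm> n)) \<and> (\<forall>n. x (Suc n) \<subseteq> x n)},
     monoid.mult = (\<lambda>x y n. x n \<otimes>\<^bsub>R Quot ideal_power R \<mm> n\<^esub> y n),
     monoid.one = (\<lambda>n. \<one>\<^bsub>R Quot ideal_power R \<mm> n\<^esub>),
     ring.zero = (\<lambda>n. \<zero>\<^bsub>R Quot ideal_power R \<mm> n\<^esub>),
     ring.add = (\<lambda>x y n. x n \<oplus>\<^bsub>R Quot ideal_power R \<mm> n\<^esub> y n)\<rparr>"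

definition completion_map :: "('a, 'r) ring_scheme \<Rightarrow> 'a set \<Rightarrow> 'a \<Rightarrow> nat \<Rightarrow> 'a set"
  where "completion_map R \<mm> r = (\<lambda>n. ideal_power R \<mm> n +>\<^bsub>R\<^esub> r)"


section \<open>Ohm-Rush modules and algebras\<close>

text \<open>The product \<open>IM\<close>: all finite sums of elements \<open>i x\<close> with \<open>i \<in> I\<close> and \<open>x \<in> M\<close>.\<close>
inductive_set ideal_smult :: "('a, 'b, 'm) module_scheme \<Rightarrow> 'a set \<Rightarrow> 'b set"
  for M and I where
    smult: "\<lbrakk>i \<in> I; x \<in> carrier M\<rbrakk> \<Longrightarrow> i \<odot>\<^bsub>M\<^esub> x \<in> ideal_smult M I"
  | sum: "\<lbrakk>s \<in> ideal_smult M I; t \<in> ideal_smult M I\<rbrakk> \<Longrightarrow> s \<oplus>\<^bsub>M\<^esub> t \<in> ideal_smult M I"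

definition content :: "('a, 'r) ring_scheme \<Rightarrow> ('a, 'b, 'm) module_scheme \<Rightarrow> 'b \<Rightarrow> 'a set"
  where "content R M f = \<Inter>{I. ideal I R \<and> f \<in> ideal_smult M I}"

definition ohm_rush :: "('a, 'r) ring_scheme \<Rightarrow> ('a, 'b, 'm) module_scheme \<Rightarrow> bool"
  where "ohm_rush R M \<longleftrightarrow> (\<forall>f \<in> carrier M. f \<in> ideal_smult M (content R M f))"

text \<open>A ring \<open>S\<close> viewed as a module over the source of a ring homomorphism \<open>\<phi>\<close> into \<open>S\<close>.\<close>
definition restrict_scalars :: "('b, 's) ring_scheme \<Rightarrow> ('a \<Rightarrow> 'b) \<Rightarrow> ('a, 'b) module"
  where "restrict_scalars S \<phi> =
    \<lparr>carrier = carrier S, monoid.mult = (\<otimes>\<^bsub>S\<^esub>), monoid.one = \<one>\<^bsub>S\<^esub>, ring.zero = \<zero>\<^bsub>S\<^esub>, ring.add = (\<oplus>\<^bsub>S\<^esub>),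
     smult = (\<lambda>r s. \<phi> r \<otimes>\<^bsub>S\<^esub> s)\<rparr>"

definition ohm_rush_hom :: "('a, 'r) ring_scheme \<Rightarrow> ('b, 's) ring_scheme \<Rightarrow> ('a \<Rightarrow> 'b) \<Rightarrow> bool"
  where "ohm_rush_hom R S \<phi> \<longleftrightarrow> \<phi> \<in> ring_hom R S \<and> ohm_rush R (restrict_scalars S \<phi>)"

definition extended_ideal ::
    "('a, 'r) ring_scheme \<Rightarrow> ('b, 's) ring_scheme \<Rightarrow> ('a \<Rightarrow> 'b) \<Rightarrow> 'b set \<Rightarrow> bool"
  where "extended_ideal R S \<phi> J \<longleftrightarrow>
    (\<exists>I. ideal I R \<and> J = ideal_smult (restrict_scalars S \<phi>) I)"


section \<open>Tensor products and faithful flatness\<close>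

definition module_hom ::
    "('a, 'r) ring_scheme \<Rightarrow> ('a, 'b, 'm) module_scheme \<Rightarrow> ('a, 'c, 'n) module_scheme \<Rightarrow> ('b \<Rightarrow> 'c) set"
  where "module_hom R M N =
    {h \<in> carrier M \<rightarrow> carrier N.
       (\<forall>x \<in> carrier M. \<forall>y \<in> carrier M. h (x \<oplus>\<^bsub>M\<^esub> y) = h x \<oplus>\<^bsub>N\<^esub> h y) \<and>
       (\<forall>r \<in> carrier R. \<forall>x \<in> carrier M. h (r \<odot>\<^bsub>M\<^esub> x) = r \<odot>\<^bsub>N\<^esub> h x)}"

definition tensor_relators ::
    "('a, 'r) ring_scheme \<Rightarrow> ('a, 'b, 'm) module_scheme \<Rightarrow> ('a, 'c, 'n) module_scheme
     \<Rightarrow> ('b \<times> 'c \<Rightarrow>\<^sub>0 int) set"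
  where "tensor_relators R M N =
    {frag_of (x \<oplus>\<^bsub>M\<^esub> x', y) - frag_of (x, y) - frag_of (x', y) | x x' y.
       x \<in> carrier M \<and> x' \<in> carrier M \<and> y \<in> carrier N} \<union>
    {frag_of (x, y \<oplus>\<^bsub>N\<^esub> y') - frag_of (x, y) - frag_of (x, y') | x y y'.
       x \<in> carrier M \<and> y \<in> carrier N \<and> y' \<in> carrier N} \<union>
    {frag_of (r \<odot>\<^bsub>M\<^esub> x, y) - frag_of (x, r \<odot>\<^bsub>N\<^esub> y) | r x y.
       r \<in> carrier R \<and> x \<in> carrier M \<and> y \<in> carrier N}"

definition tensor_kernel ::
    "('a, 'r) ring_scheme \<Rightarrow> ('a, 'b, 'm) module_scheme \<Rightarrow> ('a, 'c, 'n) module_scheme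
     \<Rightarrow> ('b \<times> 'c \<Rightarrow>\<^sub>0 int) set"
  where "tensor_kernel R M N =
    generate (free_Abelian_group (carrier M \<times> carrier N)) (tensor_relators R M N)"

text \<open>
  The underlying abelian group of \<open>M \<otimes>\<^sub>R N\<close>; the scalar multiplication is not needed to say that
  a map of tensor products is injective or that a tensor product is zero.
\<close>
definition tensor_product ::
    "('a, 'r) ring_scheme \<Rightarrow> ('a, 'b, 'm) module_scheme \<Rightarrow> ('a, 'c, 'n) module_scheme
     \<Rightarrow> ('b \<times> 'c \<Rightarrow>\<^sub>0 int) set monoid"
  where "tensor_product R M N =
    free_Abelian_group (carrier M \<times> carrier N) Mod tensor_kernel R M N"

text \<open>
  The map \<open>id \<otimes> h\<close> from \<open>M \<otimes>\<^sub>R N\<close> to \<open>M \<otimes>\<^sub>R N'\<close>. Elements of the tensor product are cosets \<open>C\<close>,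
  and multiplying the image of \<open>C\<close> by the subgroup of relations gives the whole target coset.
\<close>
definition tensor_map ::
    "('a, 'r) ring_scheme \<Rightarrow> ('a, 'b, 'm) module_scheme \<Rightarrow> ('a, 'c, 'n) module_scheme \<Rightarrow> ('c \<Rightarrow> 'c)
     \<Rightarrow> ('b \<times> 'c \<Rightarrow>\<^sub>0 int) set \<Rightarrow> ('b \<times> 'c \<Rightarrow>\<^sub>0 int) set"
  where "tensor_map R M N' h C =
    tensor_kernel R M N' <#>\<^bsub>free_Abelian_group (carrier M \<times> carrier N')\<^esub>
      (frag_extend (\<lambda>(x, y). frag_of (x, h y)) ` C)"

text \<open>
  HOL cannot quantify over types inside a formula, so the test modules range over all modules
  whose elements have type \<open>'c\<close>. A result that is polymorphic in \<open>'c\<close> covers all modules.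
\<close>
definition flat :: "'c itself \<Rightarrow> ('a, 'r) ring_scheme \<Rightarrow> ('a, 'b, 'm) module_scheme \<Rightarrow> bool"
  where "flat _ R M \<longleftrightarrow>
    (\<forall>(N :: ('a, 'c) module) (N' :: ('a, 'c) module) h.
       module R N \<and> module R N' \<and> h \<in> module_hom R N N' \<and> inj_on h (carrier N) \<longrightarrow>
       inj_on (tensor_map R M N' h) (carrier (tensor_product R M N)))"

definition faithfully_flat ::
    "'c itself \<Rightarrow> ('a, 'r) ring_scheme \<Rightarrow> ('a, 'b, 'm) module_scheme \<Rightarrow> bool"
  where "faithfully_flat T R M \<longleftrightarrow>
    flat T R M \<and>
    (\<forall>N :: ('a, 'c) module.
       module R N \<and> trivial_group (tensor_product R M N) \<longrightarrow> carrier N = {\<zero>\<^bsub>N\<^esub>})"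

definition gaussian ::
    "'c itself \<Rightarrow> ('a, 'r) ring_scheme \<Rightarrow> ('b, 's) ring_scheme \<Rightarrow> ('a \<Rightarrow> 'b) \<Rightarrow> bool"
  where "gaussian T R S \<phi> \<longleftrightarrow>
    ohm_rush_hom R S \<phi> \<and>
    faithfully_flat T R (restrict_scalars S \<phi>) \<and>
    (\<forall>f \<in> carrier S. \<forall>g \<in> carrier S.
       content R (restrict_scalars S \<phi>) (f \<otimes>\<^bsub>S\<^esub> g) =
       content R (restrict_scalars S \<phi>) f \<cdot>\<^bsub>R\<^esub> content R (restrict_scalars S \<phi>) g)"

end

theory Submission
  imports Defs
begin

text \<open>
  Let \<open>S\<close> be the completion. By Krull's intersection theorem every ideal \<open>I\<close> of \<open>R\<close> satisfies
  \<open>IS \<inter> R = I\<close>, and an element of \<open>S\<close> outside \<open>\<mm>S\<close> is a unit.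

  If \<open>S\<close> is Ohm-Rush and \<open>I = c(g)\<close>, then \<open>g \<in> IS\<close> is congruent to some \<open>a \<in> I\<close> modulo \<open>\<mm>IS\<close>, so minimality
  of the content gives \<open>I \<subseteq> aR + \<mm>I\<close>, hence \<open>I = aR\<close> and \<open>g = as\<close>; if \<open>s\<close> were in \<open>\<mm>S\<close>, minimality would give
  \<open>a \<in> \<mm>a\<close>, so \<open>a = 0\<close>. In either case \<open>gS = aS\<close>. If all ideals are extended and \<open>gS = IS\<close>, then either
  some \<open>a \<in> I\<close> is \<open>g\<close> times a unit, or \<open>g \<in> \<mm>gS\<close> and \<open>g = 0\<close>.

  Conversely, suppose that principal ideals of \<open>S\<close> are extended from principal ideals. If \<open>gS = rS\<close>, then
  \<open>c(g) = rR\<close> by contraction, which makes \<open>S\<close> Ohm-Rush and the content multiplicative, and every ideal of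
  \<open>S\<close> is generated by its contraction. For flatness, a relation \<open>\<Sum> b\<^sub>i u\<^sub>i = 0\<close> with \<open>u\<^sub>k = rs\<close>, \<open>r = u\<^sub>kt\<close>
  puts \<open>b\<^sub>kr\<close> into the ideal of the other \<open>b\<^sub>i\<close>, again by contraction, and this shortens the relation;
  so the equational criterion holds by induction.
\<close>

section \<open>Extended ideals\<close>

lemma restrict_scalars_simps [simp]:
  "carrier (restrict_scalars S h) = carrier S"
  "(\<otimes>\<^bsub>restrict_scalars S h\<^esub>) = (\<otimes>\<^bsub>S\<^esub>)"
  "\<one>\<^bsub>restrict_scalars S h\<^esub> = \<one>\<^bsub>S\<^esub>"
  "\<zero>\<^bsub>restrict_scalars S h\<^esub> = \<zero>\<^bsub>S\<^esub>"
  "(\<oplus>\<^bsub>restrict_scalars S h\<^esub>) = (\<oplus>\<^bsub>S\<^esub>)"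
  "r \<odot>\<^bsub>restrict_scalars S h\<^esub> s = h r \<otimes>\<^bsub>S\<^esub> s"
  by (simp_all add: restrict_scalars_def)

context ring_hom_cring
begin

abbreviation ext :: "'a set \<Rightarrow> 'c set"
  where "ext I \<equiv> ideal_smult (restrict_scalars S h) I"

lemma ext_mult: "i \<in> I \<Longrightarrow> s \<in> carrier S \<Longrightarrow> h i \<otimes>\<^bsub>S\<^esub> s \<in> ext I"
  using ideal_smult.smult[of i I s "restrict_scalars S h"] by simp

lemma ext_add: "s \<in> ext I \<Longrightarrow> t \<in> ext I \<Longrightarrow> s \<oplus>\<^bsub>S\<^esub> t \<in> ext I"
  using ideal_smult.sum[of s "restrict_scalars S h" I t] by simp

lemma ext_induct [consumes 1, case_names mult add]:
  assumes "x \<in> ext I"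
    and "\<And>i s. i \<in> I \<Longrightarrow> s \<in> carrier S \<Longrightarrow> P (h i \<otimes>\<^bsub>S\<^esub> s)"
    and "\<And>s t. s \<in> ext I \<Longrightarrow> P s \<Longrightarrow> t \<in> ext I \<Longrightarrow> P t \<Longrightarrow> P (s \<oplus>\<^bsub>S\<^esub> t)"
  shows "P x"
  using assms(1) by (induction rule: ideal_smult.induct) (use assms(2,3) in auto)

lemma ext_least:
  assumes "ideal J S" "\<And>i. i \<in> I \<Longrightarrow> h i \<in> J"
  shows "ext I \<subseteq> J"
proof
  interpret J: ideal J S by fact
  fix x assume "x \<in> ext I"
  then show "x \<in> J"
    by (induction rule: ext_induct) (use assms in \<open>auto intro: J.I_r_closed\<close>)
qed

text \<open>\<open>ideal_smult\<close> is only closed under sums by definition. Negatives come from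
  moving the sign into \<open>I\<close>, zero is \<open>h \<zero>\<close> times zero, and a factor
  from \<open>S\<close> is absorbed by the second factor of each generator.\<close>

lemma ext_ideal:
  assumes "ideal I R"
  shows "ideal (ext I) S"
proof (rule idealI)
  interpret I: ideal I R by fact
  have carr: "x \<in> carrier S" if "x \<in> ext I" for x
    using that by (induction rule: ext_induct) (auto dest: I.Icarr)
  have minus: "\<ominus>\<^bsub>S\<^esub> x \<in> ext I" if "x \<in> ext I" for x
    using that
  proof (induction rule: ext_induct)
    case (mult i s)
    then have "\<ominus>\<^bsub>S\<^esub> (h i \<otimes>\<^bsub>S\<^esub> s) = h (\<ominus> i) \<otimes>\<^bsub>S\<^esub> s"
      by (simp add: I.Icarr S.l_minus)
    with mult show ?case using ext_mult[of "\<ominus> i" I s] by simp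
  next
    case (add s t)
    then show ?case by (simp add: S.minus_add carr ext_add)
  qed
  show l: "x \<otimes>\<^bsub>S\<^esub> a \<in> ext I" if "a \<in> ext I" "x \<in> carrier S" for a x
    using that(1)
  proof (induction rule: ext_induct)
    case (mult i s)
    then have "x \<otimes>\<^bsub>S\<^esub> (h i \<otimes>\<^bsub>S\<^esub> s) = h i \<otimes>\<^bsub>S\<^esub> (x \<otimes>\<^bsub>S\<^esub> s)"
      using that by (simp add: I.Icarr S.m_lcomm)
    with mult that show ?case by (simp add: ext_mult)
  next
    case (add s t)
    then show ?case by (simp add: S.r_distr carr ext_add that)
  qed
  show "a \<otimes>\<^bsub>S\<^esub> x \<in> ext I" if "a \<in> ext I" "x \<in> carrier S" for a x
    using l[OF that] that carr S.m_comm by metis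
  show "subgroup (ext I) (add_monoid S)"
  proof
    show "ext I \<subseteq> carrier (add_monoid S)" using carr by auto
    show "\<one>\<^bsub>add_monoid S\<^esub> \<in> ext I"
      using ext_mult[OF I.zero_closed S.zero_closed] by simp
    show "inv\<^bsub>add_monoid S\<^esub> x \<in> ext I" if "x \<in> ext I" for x
      using minus[OF that] by (simp add: a_inv_def)
  qed (simp add: ext_add)
qed (rule S.ring_axioms)

lemma ext_mono: "I \<subseteq> J \<Longrightarrow> ext I \<subseteq> ext J"
proof
  fix x assume "I \<subseteq> J" "x \<in> ext I"
  from this(2) show "x \<in> ext J"
    by (induction rule: ext_induct) (use \<open>I \<subseteq> J\<close> in \<open>auto intro: ext_mult ext_add\<close>)
qed

lemma hom_in_ext:
  assumes "i \<in> I" "i \<in> carrier R"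
  shows "h i \<in> ext I"
  using ext_mult[OF assms(1) S.one_closed] assms(2) by simp

lemma ext_PIdl:
  assumes "r \<in> carrier R"
  shows "ext (PIdl r) = PIdl\<^bsub>S\<^esub> (h r)"
proof
  show "ext (PIdl r) \<subseteq> PIdl\<^bsub>S\<^esub> (h r)"
  proof (rule ext_least)
    show "h i \<in> PIdl\<^bsub>S\<^esub> (h r)" if "i \<in> PIdl r" for i
      using that assms by (auto simp: cgenideal_def)
  qed (use assms S.cgenideal_ideal in simp)
  show "PIdl\<^bsub>S\<^esub> (h r) \<subseteq> ext (PIdl r)"
    by (rule S.cgenideal_minimal[OF ext_ideal])
      (use assms in \<open>auto intro: hom_in_ext R.cgenideal_ideal R.cgenideal_self\<close>)
qed

end

section \<open>Principal ideals and divisibility\<close>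

lemma (in cring) PIdl_subset_iff:
  assumes "a \<in> carrier R" "b \<in> carrier R"
  shows "PIdl a \<subseteq> PIdl b \<longleftrightarrow> (\<exists>c \<in> carrier R. a = b \<otimes> c)"
  using assms by (simp add: to_contain_is_to_divide factor_def)

lemma (in cring) PIdl_eq_iff:
  assumes "a \<in> carrier R" "b \<in> carrier R"
  shows "PIdl a = PIdl b \<longleftrightarrow> (\<exists>c \<in> carrier R. a = b \<otimes> c) \<and> (\<exists>d \<in> carrier R. b = a \<otimes> d)"
  using assms PIdl_subset_iff by (metis subset_antisym order_refl)

lemma (in cring) PIdl_mult_unit:
  assumes "a \<in> carrier R" "s \<in> Units R"
  shows "PIdl (a \<otimes> s) = PIdl a"
proof -
  have "a = a \<otimes> s \<otimes> inv s"
    using m_assoc[OF assms(1) Units_closed[OF assms(2)] Units_inv_closed[OF assms(2)]]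
      Units_r_inv[OF assms(2)] r_one[OF assms(1)] by simp
  with assms show ?thesis
    by (subst PIdl_eq_iff) (auto intro: bexI[of _ s] bexI[of _ "inv s"])
qed

lemma (in cring) PIdl_mult:
  assumes "a \<in> carrier R" "b \<in> carrier R"
  shows "PIdl (a \<otimes> b) = (PIdl a) \<cdot> (PIdl b)"
proof
  note ideals = cgenideal_ideal[OF assms(1)] cgenideal_ideal[OF assms(2)]
  show "PIdl (a \<otimes> b) \<subseteq> (PIdl a) \<cdot> (PIdl b)"
    using assms ideals
    by (intro cgenideal_minimal ideal_prod_is_ideal ideal_prod.prod cgenideal_self)
  have "(PIdl a) <#> (PIdl b) \<subseteq> PIdl (a \<otimes> b)"
    using assms by (simp add: cgenideal_prod)
  then show "(PIdl a) \<cdot> (PIdl b) \<subseteq> PIdl (a \<otimes> b)"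
    using assms ideals
    by (simp add: ideal_prod_eq_genideal genideal_minimal cgenideal_ideal)
qed

text \<open>
  These two conditions alone make \<open>S\<close> Gaussian over \<open>R\<close>, with no Noetherian or local hypothesis.
\<close>
locale principally_extended = ring_hom_cring R S h for R (structure) and S (structure) and h +
  assumes contraction: "\<lbrakk>ideal I R; r \<in> carrier R; h r \<in> ext I\<rbrakk> \<Longrightarrow> r \<in> I"
    and principal: "g \<in> carrier S \<Longrightarrow> \<exists>r \<in> carrier R. PIdl\<^bsub>S\<^esub> g = PIdl\<^bsub>S\<^esub> (h r)"
begin

text \<open>Generators of the same ideal divide each other, but \<open>S\<close> may have zero
  divisors, so \<open>s\<close> and \<open>t\<close> need not be inverse to each other. The later
  arguments rest on the two divisibilities.\<close>

lemma principal_factor: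
  assumes "g \<in> carrier S"
  obtains r s t where "r \<in> carrier R" "s \<in> carrier S" "t \<in> carrier S"
    "g = h r \<otimes>\<^bsub>S\<^esub> s" "h r = g \<otimes>\<^bsub>S\<^esub> t"
  using principal[OF assms] assms by (auto simp: S.PIdl_eq_iff)

text \<open>If \<open>g \<in> ext I\<close>, then \<open>h r\<close>, a multiple of
  \<open>g\<close>, lies in \<open>ext I\<close> too and contraction puts \<open>r\<close> into
  \<open>I\<close>. So \<open>PIdl r\<close> is the least of the ideals whose extension contains
  \<open>g\<close>.\<close>

lemma content_principal:
  assumes "r \<in> carrier R" "g \<in> carrier S" "PIdl\<^bsub>S\<^esub> g = PIdl\<^bsub>S\<^esub> (h r)"
  shows "content R (restrict_scalars S h) g = PIdl r"
proof
  show "content R (restrict_scalars S h) g \<subseteq> PIdl r"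
    using assms S.cgenideal_self[OF assms(2)]
    by (auto simp: content_def R.cgenideal_ideal ext_PIdl)
  show "PIdl r \<subseteq> content R (restrict_scalars S h) g"
    unfolding content_def
  proof (rule Inter_greatest, clarify)
    fix I r' assume I: "ideal I R" "g \<in> ext I" "r' \<in> PIdl r"
    have "h r \<in> PIdl\<^bsub>S\<^esub> g"
      using assms S.cgenideal_self by auto
    with S.cgenideal_minimal[OF ext_ideal[OF I(1)] I(2)] have "r \<in> I"
      using contraction[OF I(1) assms(1)] by auto
    with R.cgenideal_minimal[OF I(1)] I(3) show "r' \<in> I" by auto
  qed
qed

lemma is_ohm_rush: "ohm_rush_hom R S h"
  unfolding ohm_rush_hom_def ohm_rush_def
proof (intro conjI ballI)
  fix g assume "g \<in> carrier (restrict_scalars S h)"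
  then have g: "g \<in> carrier S" by simp
  with principal obtain r where r: "r \<in> carrier R" "PIdl\<^bsub>S\<^esub> g = PIdl\<^bsub>S\<^esub> (h r)" by blast
  with g show "g \<in> ext (content R (restrict_scalars S h) g)"
    using S.cgenideal_self[OF g] by (simp add: content_principal ext_PIdl)
qed (rule homh)

lemma content_mult:
  assumes "f \<in> carrier S" "g \<in> carrier S"
  shows "content R (restrict_scalars S h) (f \<otimes>\<^bsub>S\<^esub> g) =
    content R (restrict_scalars S h) f \<cdot> content R (restrict_scalars S h) g"
proof -
  obtain a where a: "a \<in> carrier R" "PIdl\<^bsub>S\<^esub> f = PIdl\<^bsub>S\<^esub> (h a)" using principal assms by blast
  obtain b where b: "b \<in> carrier R" "PIdl\<^bsub>S\<^esub> g = PIdl\<^bsub>S\<^esub> (h b)" using principal assms by blast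
  have "PIdl\<^bsub>S\<^esub> (f \<otimes>\<^bsub>S\<^esub> g) = PIdl\<^bsub>S\<^esub> (h (a \<otimes> b))"
    using a b assms by (simp flip: S.cgenideal_prod)
  then have "content R (restrict_scalars S h) (f \<otimes>\<^bsub>S\<^esub> g) = PIdl (a \<otimes> b)"
    using a b assms by (intro content_principal) auto
  also have "\<dots> = (PIdl a) \<cdot> (PIdl b)"
    using a(1) b(1) by (rule R.PIdl_mult)
  finally show ?thesis using a b assms by (simp add: content_principal)
qed

text \<open>\<open>?I\<close> is the contraction of \<open>J\<close>. For \<open>g \<in> J\<close>
  with \<open>g = h r s\<close> and \<open>h r = g t\<close>, the second equation puts
  \<open>r\<close> into the contraction and the first then puts \<open>g\<close> into its
  extension.\<close>

lemma ideal_extended: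
  assumes "ideal J S"
  shows "extended_ideal R S h J"
proof -
  interpret J: ideal J S by fact
  let ?I = "{r \<in> carrier R. h r \<in> J}"
  have "ideal ?I R"
    by (rule idealI, rule R.ring_axioms, unfold_locales)
      (auto simp: J.I_l_closed J.I_r_closed simp flip: a_inv_def)
  moreover have "J = ext ?I"
  proof
    show "J \<subseteq> ext ?I"
    proof
      fix g assume g: "g \<in> J"
      obtain r s t where "r \<in> carrier R" "s \<in> carrier S" "t \<in> carrier S"
        "g = h r \<otimes>\<^bsub>S\<^esub> s" "h r = g \<otimes>\<^bsub>S\<^esub> t"
        using principal_factor[of g] g J.Icarr by metis
      with g show "g \<in> ext ?I"
        by (metis (mono_tags, lifting) J.I_r_closed ext_mult mem_Collect_eq)
    qed
    show "ext ?I \<subseteq> J" by (rule ext_least) (use assms in auto)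
  qed
  ultimately show ?thesis unfolding extended_ideal_def by blast
qed

end

section \<open>The equational criterion for flatness\<close>

context ring_hom_cring
begin

text \<open>
  Lists of coordinate functions \<open>l\<^sub>i\<close> on \<open>S\<close> take the place of maps to free modules \<open>R\<^sup>n\<close>: if
  \<open>F x = \<Sum> h (l\<^sub>i x) u\<^sub>i\<close> and \<open>F\<close> is the identity on a finite set, then the \<open>l\<^sub>i\<close> lift that set along
  the map \<open>R\<^sup>n \<rightarrow> S\<close> given by the \<open>u\<^sub>i\<close>.
\<close>
primrec R_span :: "('c \<Rightarrow> 'a) list \<Rightarrow> ('c \<Rightarrow> 'a) set"
  where
    "R_span [] = {\<lambda>x. \<zero>}"
  | "R_span (l # ls) = {\<lambda>x. c \<otimes> l x \<oplus> k x |c k. c \<in> carrier R \<and> k \<in> R_span ls}"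

primrec S_span :: "('c \<Rightarrow> 'a) list \<Rightarrow> ('c \<Rightarrow> 'c) set"
  where
    "S_span [] = {\<lambda>x. \<zero>\<^bsub>S\<^esub>}"
  | "S_span (l # ls) = {\<lambda>x. h (l x) \<otimes>\<^bsub>S\<^esub> u \<oplus>\<^bsub>S\<^esub> F x |u F. u \<in> carrier S \<and> F \<in> S_span ls}"

text \<open>The condition ranges over the whole type, so no argument has to be checked for
  membership in \<open>carrier S\<close>. Linearity is not built in; \<open>defect\<close> measures
  it one relation at a time.\<close>

definition coordinate :: "('c \<Rightarrow> 'a) \<Rightarrow> bool"
  where "coordinate l \<longleftrightarrow> range l \<subseteq> carrier R"

lemma coordinateD [simp]: "coordinate l \<Longrightarrow> l x \<in> carrier R"
  by (auto simp: coordinate_def)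

lemma coordinateI: "(\<And>x. l x \<in> carrier R) \<Longrightarrow> coordinate l"
  by (auto simp: coordinate_def)

lemma R_span_ConsI:
  assumes "c \<in> carrier R" "k \<in> R_span ls" "\<And>x. k' x = c \<otimes> l x \<oplus> k x"
  shows "k' \<in> R_span (l # ls)"
  using assms by (auto simp: fun_eq_iff)

lemma S_span_ConsI:
  assumes "u \<in> carrier S" "F \<in> S_span ls" "\<And>x. F' x = h (l x) \<otimes>\<^bsub>S\<^esub> u \<oplus>\<^bsub>S\<^esub> F x"
  shows "F' \<in> S_span (l # ls)"
  using assms by (auto simp: fun_eq_iff)

lemma R_span_coordinate:
  assumes "\<forall>l \<in> set ls. coordinate l" "k \<in> R_span ls"
  shows "coordinate k"
  using assms
proof (induction ls arbitrary: k)
  case (Cons l ls)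
  then obtain c k1 where "c \<in> carrier R" "coordinate k1" "k = (\<lambda>x. c \<otimes> l x \<oplus> k1 x)"
    by auto
  with Cons.prems show ?case by (auto intro!: coordinateI)
qed (auto intro: coordinateI)

lemma S_span_closed:
  assumes "\<forall>l \<in> set ls. coordinate l" "F \<in> S_span ls"
  shows "F x \<in> carrier S"
  using assms
proof (induction ls arbitrary: F)
  case (Cons l ls)
  then obtain u F1 where "u \<in> carrier S" "F1 x \<in> carrier S" "F = (\<lambda>x. h (l x) \<otimes>\<^bsub>S\<^esub> u \<oplus>\<^bsub>S\<^esub> F1 x)"
    by auto
  with Cons.prems show ?case by auto
qed auto

lemma R_span_zero:
  assumes "\<forall>l \<in> set ls. coordinate l"
  shows "(\<lambda>x. \<zero>) \<in> R_span ls"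
  using assms
proof (induction ls)
  case (Cons l ls)
  then show ?case by (intro R_span_ConsI[of \<zero> "\<lambda>x. \<zero>"]) auto
qed auto

lemma R_span_add:
  assumes "\<forall>l \<in> set ls. coordinate l" "k \<in> R_span ls" "k' \<in> R_span ls"
  shows "(\<lambda>x. k x \<oplus> k' x) \<in> R_span ls"
  using assms
proof (induction ls arbitrary: k k')
  case (Cons l ls)
  then obtain c k1 c' k1' where k: "c \<in> carrier R" "k1 \<in> R_span ls" "k = (\<lambda>x. c \<otimes> l x \<oplus> k1 x)"
    "c' \<in> carrier R" "k1' \<in> R_span ls" "k' = (\<lambda>x. c' \<otimes> l x \<oplus> k1' x)"
    by auto
  moreover have "coordinate l" "coordinate k1" "coordinate k1'"
    using k Cons.prems R_span_coordinate[of ls] by auto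
  ultimately have "k x \<oplus> k' x = (c \<oplus> c') \<otimes> l x \<oplus> (k1 x \<oplus> k1' x)" for x
    by (simp add: R.l_distr R.a_ac)
  then show ?case
    by (rule R_span_ConsI[rotated 2]) (use k Cons in auto)
qed auto

lemma R_span_smult:
  assumes "\<forall>l \<in> set ls. coordinate l" "k \<in> R_span ls" "r \<in> carrier R"
  shows "(\<lambda>x. r \<otimes> k x) \<in> R_span ls"
  using assms
proof (induction ls arbitrary: k)
  case (Cons l ls)
  then obtain c k1 where k: "c \<in> carrier R" "k1 \<in> R_span ls" "k = (\<lambda>x. c \<otimes> l x \<oplus> k1 x)"
    by auto
  moreover have "coordinate l" "coordinate k1"
    using k Cons.prems R_span_coordinate[of ls] by auto
  ultimately have "r \<otimes> k x = (r \<otimes> c) \<otimes> l x \<oplus> r \<otimes> k1 x" for x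
    using Cons.prems by (simp add: R.r_distr R.m_assoc)
  then show ?case
    by (rule R_span_ConsI[rotated 2]) (use k Cons in auto)
qed auto

text \<open>When \<open>k\<close> is expanded in the functions of the list, its coefficients times
  \<open>s\<close> are absorbed into the coefficients of \<open>F\<close>, so the list does not
  grow. This allows \<open>S_span_respecting\<close> to trade the head of a list for a corrected
  function while the rest stays in the span of the tail.\<close>

lemma S_span_R_span:
  assumes "\<forall>l \<in> set ls. coordinate l" "k \<in> R_span ls" "F \<in> S_span ls" "s \<in> carrier S"
  shows "(\<lambda>x. h (k x) \<otimes>\<^bsub>S\<^esub> s \<oplus>\<^bsub>S\<^esub> F x) \<in> S_span ls"
  using assms
proof (induction ls arbitrary: k F)
  case (Cons l ls)
  then obtain c k1 u F1 where k: "c \<in> carrier R" "k1 \<in> R_span ls" "k = (\<lambda>x. c \<otimes> l x \<oplus> k1 x)"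
    "u \<in> carrier S" "F1 \<in> S_span ls" "F = (\<lambda>x. h (l x) \<otimes>\<^bsub>S\<^esub> u \<oplus>\<^bsub>S\<^esub> F1 x)"
    by auto
  moreover have "coordinate l" "coordinate k1" "\<And>x. F1 x \<in> carrier S"
    using k Cons.prems R_span_coordinate[of ls] S_span_closed[of ls] by auto
  ultimately have "h (k x) \<otimes>\<^bsub>S\<^esub> s \<oplus>\<^bsub>S\<^esub> F x =
      h (l x) \<otimes>\<^bsub>S\<^esub> (h c \<otimes>\<^bsub>S\<^esub> s \<oplus>\<^bsub>S\<^esub> u) \<oplus>\<^bsub>S\<^esub> (h (k1 x) \<otimes>\<^bsub>S\<^esub> s \<oplus>\<^bsub>S\<^esub> F1 x)" for x
    using Cons.prems(4) by (simp add: S.r_distr S.l_distr S.m_ac S.a_ac)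
  then show ?case
    by (rule S_span_ConsI[rotated 2]) (use k Cons in auto)
qed auto

text \<open>The coordinate functions are indicator functions of the single points of
  \<open>T\<close>, with the point itself as coefficient. That \<open>F\<close> vanishes outside
  \<open>T\<close> serves the induction: at the new point \<open>s\<close> only the new indicator
  contributes.\<close>

lemma S_span_identity:
  assumes "finite T" "T \<subseteq> carrier S"
  obtains ls F where "\<forall>l \<in> set ls. coordinate l" "F \<in> S_span ls" "\<And>t. t \<in> T \<Longrightarrow> F t = t"
    "\<And>t. t \<notin> T \<Longrightarrow> F t = \<zero>\<^bsub>S\<^esub>"
  using assms
proof (induction T arbitrary: thesis rule: finite_induct)
  case empty
  show ?case by (rule empty(1)[of "[]"]) auto
next
  case (insert s T)
  from insert.IH insert.prems obtain ls F where F: "\<forall>l \<in> set ls. coordinate l" "F \<in> S_span ls"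
    "\<And>t. t \<in> T \<Longrightarrow> F t = t" "\<And>t. t \<notin> T \<Longrightarrow> F t = \<zero>\<^bsub>S\<^esub>"
    by (metis insert_subset)
  define l :: "'c \<Rightarrow> 'a" where "l x = (if x = s then \<one> else \<zero>)" for x
  show ?case
  proof (rule insert.prems(1)[of "l # ls"])
    show "\<forall>l \<in> set (l # ls). coordinate l"
      using F by (auto simp: l_def intro!: coordinateI)
    show "(\<lambda>x. h (l x) \<otimes>\<^bsub>S\<^esub> s \<oplus>\<^bsub>S\<^esub> F x) \<in> S_span (l # ls)"
      using F insert.prems by (intro S_span_ConsI[of s F]) auto
    show "h (l x) \<otimes>\<^bsub>S\<^esub> s \<oplus>\<^bsub>S\<^esub> F x = x" if "x \<in> insert s T" for x
      using that F insert.prems insert.hyps by (auto simp: l_def)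
    show "h (l x) \<otimes>\<^bsub>S\<^esub> s \<oplus>\<^bsub>S\<^esub> F x = \<zero>\<^bsub>S\<^esub>" if "x \<notin> insert s T" for x
      using that F insert.prems insert.hyps by (auto simp: l_def)
  qed
qed

text \<open>A tuple \<open>(a, x, b, y)\<close> stands for the requirement that a coordinate function respect \<open>a x + b y\<close>.\<close>
definition comb :: "'a \<times> 'c \<times> 'a \<times> 'c \<Rightarrow> 'c"
  where "comb = (\<lambda>(a, x, b, y). h a \<otimes>\<^bsub>S\<^esub> x \<oplus>\<^bsub>S\<^esub> h b \<otimes>\<^bsub>S\<^esub> y)"

definition defect :: "'a \<times> 'c \<times> 'a \<times> 'c \<Rightarrow> ('c \<Rightarrow> 'a) \<Rightarrow> 'a"
  where "defect = (\<lambda>(a, x, b, y) l. l (comb (a, x, b, y)) \<ominus> (a \<otimes> l x \<oplus> b \<otimes> l y))"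

definition S_defect :: "'a \<times> 'c \<times> 'a \<times> 'c \<Rightarrow> ('c \<Rightarrow> 'c) \<Rightarrow> 'c"
  where "S_defect = (\<lambda>(a, x, b, y) F. F (comb (a, x, b, y)) \<ominus>\<^bsub>S\<^esub> (h a \<otimes>\<^bsub>S\<^esub> F x \<oplus>\<^bsub>S\<^esub> h b \<otimes>\<^bsub>S\<^esub> F y))"

abbreviation combs :: "('a \<times> 'c \<times> 'a \<times> 'c) set"
  where "combs \<equiv> carrier R \<times> carrier S \<times> carrier R \<times> carrier S"

lemma defect_closed [simp]: "q \<in> combs \<Longrightarrow> coordinate l \<Longrightarrow> defect q l \<in> carrier R"
  by (auto simp: defect_def)

lemma defect_linear:
  assumes "q \<in> combs" "c \<in> carrier R" "coordinate l" "coordinate k"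
  shows "defect q (\<lambda>x. c \<otimes> l x \<oplus> k x) = c \<otimes> defect q l \<oplus> defect q k"
proof -
  obtain a x b y where q: "q = (a, x, b, y)" "a \<in> carrier R" "b \<in> carrier R"
    using assms by (cases q) auto
  have "c \<otimes> lz \<oplus> kz \<ominus> (a \<otimes> (c \<otimes> lx \<oplus> kx) \<oplus> b \<otimes> (c \<otimes> ly \<oplus> ky)) =
      c \<otimes> (lz \<ominus> (a \<otimes> lx \<oplus> b \<otimes> ly)) \<oplus> (kz \<ominus> (a \<otimes> kx \<oplus> b \<otimes> ky))"
    if "lz \<in> carrier R" "kz \<in> carrier R" "lx \<in> carrier R" "kx \<in> carrier R" "ly \<in> carrier R" "ky \<in> carrier R"
    for lz kz lx kx ly ky
    using that assms(2) q by algebra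
  with assms q show ?thesis by (simp add: defect_def)
qed

text \<open>Applied along the list, this turns the defect of \<open>F\<close> into
  \<open>\<Sum> h (defect q l_i) u_i\<close>; a vanishing \<open>S_defect\<close> is thus a linear
  relation over \<open>S\<close> between images of elements of \<open>R\<close>.\<close>

lemma S_defect_linear:
  assumes "q \<in> combs" "u \<in> carrier S" "coordinate l" "\<And>x. F x \<in> carrier S"
  shows "S_defect q (\<lambda>x. h (l x) \<otimes>\<^bsub>S\<^esub> u \<oplus>\<^bsub>S\<^esub> F x) = h (defect q l) \<otimes>\<^bsub>S\<^esub> u \<oplus>\<^bsub>S\<^esub> S_defect q F"
proof -
  obtain a x b y where q: "q = (a, x, b, y)" "a \<in> carrier R" "b \<in> carrier R"
    using assms by (cases q) auto
  have "lz \<otimes>\<^bsub>S\<^esub> u \<oplus>\<^bsub>S\<^esub> kz \<ominus>\<^bsub>S\<^esub> (h a \<otimes>\<^bsub>S\<^esub> (lx \<otimes>\<^bsub>S\<^esub> u \<oplus>\<^bsub>S\<^esub> kx) \<oplus>\<^bsub>S\<^esub> h b \<otimes>\<^bsub>S\<^esub> (ly \<otimes>\<^bsub>S\<^esub> u \<oplus>\<^bsub>S\<^esub> ky)) =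
      (lz \<oplus>\<^bsub>S\<^esub> \<ominus>\<^bsub>S\<^esub> (h a \<otimes>\<^bsub>S\<^esub> lx \<oplus>\<^bsub>S\<^esub> h b \<otimes>\<^bsub>S\<^esub> ly)) \<otimes>\<^bsub>S\<^esub> u \<oplus>\<^bsub>S\<^esub> (kz \<ominus>\<^bsub>S\<^esub> (h a \<otimes>\<^bsub>S\<^esub> kx \<oplus>\<^bsub>S\<^esub> h b \<otimes>\<^bsub>S\<^esub> ky))"
    if "lz \<in> carrier S" "kz \<in> carrier S" "lx \<in> carrier S" "kx \<in> carrier S" "ly \<in> carrier S" "ky \<in> carrier S"
      "h a \<in> carrier S" "h b \<in> carrier S"
    for lz kz lx kx ly ky
    using that assms(2) by algebra
  with assms q show ?thesis by (simp add: defect_def S_defect_def R.minus_eq)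
qed

end

section \<open>Coordinate functions that respect given linear relations\<close>

context principally_extended
begin

text \<open>\<open>defect q\<close> is \<open>R\<close>-linear on coordinate functions, so it maps
  the \<open>R\<close>-module \<open>R_span ls\<close> onto an ideal of \<open>R\<close>, to which
  contraction can be applied.\<close>

lemma defect_R_span_ideal:
  assumes "q \<in> combs" "\<forall>l \<in> set ls. coordinate l"
  shows "ideal (defect q ` R_span ls) R"
proof -
  note coord = R_span_coordinate[OF assms(2)]
  have zero: "defect q (\<lambda>x. \<zero>) = \<zero>"
    using assms(1) by (auto simp: defect_def)
  have c0: "coordinate (\<lambda>x. \<zero>)" by (auto intro!: coordinateI)
  have smult: "defect q (\<lambda>x. r \<otimes> k x) = r \<otimes> defect q k" if "r \<in> carrier R" "coordinate k" for r k
    using defect_linear[OF assms(1) that c0] zero that assms(1) by simp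
  have add: "defect q (\<lambda>x. k x \<oplus> k' x) = defect q k \<oplus> defect q k'" if "coordinate k" "coordinate k'" for k k'
    using defect_linear[OF assms(1) R.one_closed that] that assms(1) by simp
  have mult: "r \<otimes> a \<in> defect q ` R_span ls" if "a \<in> defect q ` R_span ls" "r \<in> carrier R" for a r
  proof -
    from that(1) obtain k where "k \<in> R_span ls" "a = defect q k" by blast
    then show ?thesis
      using that(2) by (intro image_eqI[of _ _ "\<lambda>x. r \<otimes> k x"])
        (simp_all add: smult coord R_span_smult[OF assms(2)])
  qed
  have carr: "a \<in> carrier R" if "a \<in> defect q ` R_span ls" for a
    using that assms coord by auto
  show ?thesis
  proof (rule idealI)
    show "subgroup (defect q ` R_span ls) (add_monoid R)"
    proof
      show "\<one>\<^bsub>add_monoid R\<^esub> \<in> defect q ` R_span ls"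
        using zero R_span_zero[OF assms(2)] by force
      show "inv\<^bsub>add_monoid R\<^esub> a \<in> defect q ` R_span ls" if "a \<in> defect q ` R_span ls" for a
        using mult[OF that, of "\<ominus> \<one>"] carr[OF that] by (simp add: R.l_minus flip: a_inv_def)
      show "a \<otimes>\<^bsub>add_monoid R\<^esub> b \<in> defect q ` R_span ls"
        if "a \<in> defect q ` R_span ls" "b \<in> defect q ` R_span ls" for a b
      proof -
        from that obtain k k' where "k \<in> R_span ls" "a = defect q k" "k' \<in> R_span ls" "b = defect q k'"
          by blast
        then show ?thesis
          by (intro image_eqI[of _ _ "\<lambda>x. k x \<oplus> k' x"]) (simp_all add: add coord R_span_add[OF assms(2)])
      qed
    qed (use carr in auto)
    show "a \<otimes> r \<in> defect q ` R_span ls" if "a \<in> defect q ` R_span ls" "r \<in> carrier R" for a r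
      using mult[OF that] carr[OF that(1)] that(2) by (simp add: R.m_comm)
  qed (use mult R.ring_axioms in auto)
qed

lemma S_defect_in_ext:
  assumes "q \<in> combs" "\<forall>l \<in> set ls. coordinate l" "F \<in> S_span ls"
  shows "S_defect q F \<in> ext (defect q ` R_span ls)"
  using assms(2,3)
proof (induction ls arbitrary: F)
  case Nil
  interpret I: ideal "ext (defect q ` R_span [])" S
    by (rule ext_ideal, rule defect_R_span_ideal[OF assms(1)]) simp
  have "S_defect q F = \<zero>\<^bsub>S\<^esub>"
    using Nil assms(1) by (auto simp: S_defect_def)
  then show ?case by (simp del: R_span.simps)
next
  case (Cons l ls)
  interpret I: ideal "ext (defect q ` R_span (l # ls))" S
    by (rule ext_ideal, rule defect_R_span_ideal[OF assms(1) Cons.prems(1)])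
  obtain u F1 where F: "u \<in> carrier S" "F1 \<in> S_span ls" "F = (\<lambda>x. h (l x) \<otimes>\<^bsub>S\<^esub> u \<oplus>\<^bsub>S\<^esub> F1 x)"
    using Cons.prems by auto
  have ls: "\<forall>l \<in> set ls. coordinate l" and l: "coordinate l" using Cons.prems by auto
  have "k \<in> R_span (l # ls)" if "k \<in> R_span ls" for k
    by (rule R_span_ConsI[OF R.zero_closed that]) (use R_span_coordinate[OF ls that] l in auto)
  then have "ext (defect q ` R_span ls) \<subseteq> ext (defect q ` R_span (l # ls))"
    by (intro ext_mono) blast
  then have 1: "S_defect q F1 \<in> ext (defect q ` R_span (l # ls))"
    using Cons.IH[OF ls F(2)] by blast
  have "l \<in> R_span (l # ls)"
    by (rule R_span_ConsI[OF R.one_closed R_span_zero[OF ls]]) (use l in auto)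
  then have 2: "h (defect q l) \<otimes>\<^bsub>S\<^esub> u \<in> ext (defect q ` R_span (l # ls))"
    using F(1) by (intro ext_mult) auto
  show ?case
    using S_defect_linear[OF assms(1) F(1) l S_span_closed[OF ls F(2)]] F(3) 1 2 by (simp del: R_span.simps)
qed

text \<open>\<open>\<Lambda>\<close> will be the set of functions that respect the relations already
  dealt with. Closure under \<open>c l + k\<close> keeps the correction terms, taken from the span,
  inside it.\<close>

lemma R_span_subset:
  assumes "set ls \<subseteq> \<Lambda>" "\<forall>l \<in> set ls. coordinate l" "(\<lambda>x. \<zero>) \<in> \<Lambda>"
    and lin: "\<And>c l k. \<lbrakk>c \<in> carrier R; coordinate l; coordinate k; l \<in> \<Lambda>; k \<in> \<Lambda>\<rbrakk> \<Longrightarrow> (\<lambda>x. c \<otimes> l x \<oplus> k x) \<in> \<Lambda>"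
  shows "R_span ls \<subseteq> \<Lambda>"
  using assms(1-3)
proof (induction ls)
  case (Cons l ls)
  show ?case
  proof
    fix k assume "k \<in> R_span (l # ls)"
    then obtain c k1 where k: "c \<in> carrier R" "k1 \<in> R_span ls" "k = (\<lambda>x. c \<otimes> l x \<oplus> k1 x)"
      by auto
    moreover have "coordinate k1" using Cons.prems k R_span_coordinate[of ls] by auto
    ultimately show "k \<in> \<Lambda>"
      unfolding k(3) using Cons by (intro lin) auto
  qed
qed auto

text \<open>
  This is the equational criterion for flatness. If \<open>F = h l u + \<dots>\<close> and \<open>u = h r s\<close> with \<open>h r = u t\<close>,
  then \<open>r\<close> times the defect of \<open>l\<close> lies in the ideal of defects of the other coordinate functions by
  contraction; subtracting such a combination from \<open>r l\<close> gives a coordinate function without defect.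
\<close>
lemma S_span_respecting:
  assumes "q \<in> combs" "\<forall>l \<in> set ls. coordinate l" "F \<in> S_span ls" "S_defect q F = \<zero>\<^bsub>S\<^esub>"
    and \<Lambda>: "set ls \<subseteq> \<Lambda>" "(\<lambda>x. \<zero>) \<in> \<Lambda>"
      "\<And>c l k. \<lbrakk>c \<in> carrier R; coordinate l; coordinate k; l \<in> \<Lambda>; k \<in> \<Lambda>\<rbrakk> \<Longrightarrow> (\<lambda>x. c \<otimes> l x \<oplus> k x) \<in> \<Lambda>"
  obtains ls' where "\<forall>l \<in> set ls'. coordinate l \<and> l \<in> \<Lambda> \<and> defect q l = \<zero>" "F \<in> S_span ls'"
  using assms(2-4) \<Lambda>(1)
proof (induction ls arbitrary: F thesis)
  case Nil
  show ?case by (rule Nil(1)[of "[]"]) (use Nil in auto)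
next
  case (Cons l ls)
  obtain u F1 where F: "u \<in> carrier S" "F1 \<in> S_span ls" "F = (\<lambda>x. h (l x) \<otimes>\<^bsub>S\<^esub> u \<oplus>\<^bsub>S\<^esub> F1 x)"
    using Cons.prems by auto
  have ls: "\<forall>l \<in> set ls. coordinate l" and l: "coordinate l" "l \<in> \<Lambda>" using Cons.prems by auto
  have "R_span ls \<subseteq> \<Lambda>" using Cons.prems(5) ls by (intro R_span_subset \<Lambda>) auto
  then have ls\<Lambda>: "k \<in> \<Lambda>" if "k \<in> R_span ls" for k using that by auto
  note F1 = S_span_closed[OF ls F(2)]
  let ?I = "defect q ` R_span ls"
  interpret I: ideal ?I R by (rule defect_R_span_ideal[OF assms(1) ls])
  interpret E: ideal "ext ?I" S by (rule ext_ideal[OF I.is_ideal])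
  obtain r s t where r: "r \<in> carrier R" "s \<in> carrier S" "t \<in> carrier S"
    "u = h r \<otimes>\<^bsub>S\<^esub> s" "h r = u \<otimes>\<^bsub>S\<^esub> t"
    using principal_factor[OF F(1)] .
  have dl: "defect q l \<in> carrier R" using assms(1) l by simp
  have SF1: "S_defect q F1 \<in> ext ?I" by (rule S_defect_in_ext[OF assms(1) ls F(2)])
  have "h (defect q l) \<otimes>\<^bsub>S\<^esub> u \<oplus>\<^bsub>S\<^esub> S_defect q F1 = \<zero>\<^bsub>S\<^esub>"
    using Cons.prems(4) F S_defect_linear[OF assms(1) F(1) l(1) F1] by simp
  then have "h (defect q l) \<otimes>\<^bsub>S\<^esub> u = \<ominus>\<^bsub>S\<^esub> S_defect q F1"
    using dl F(1) E.Icarr[OF SF1] by (simp add: S.minus_equality)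
  then have "(h (defect q l) \<otimes>\<^bsub>S\<^esub> u) \<otimes>\<^bsub>S\<^esub> t \<in> ext ?I"
    using SF1 r(3) by (simp add: E.I_r_closed)
  then have "h (defect q l \<otimes> r) \<in> ext ?I"
    using r(1,3) dl F(1) by (simp add: S.m_assoc r(5))
  then have "defect q l \<otimes> r \<in> ?I"
    using contraction[OF I.is_ideal] dl r(1) by simp
  then obtain k where k: "k \<in> R_span ls" "defect q k = r \<otimes> defect q l"
    using dl r(1) by (auto simp: R.m_comm)
  have kc: "coordinate k" by (rule R_span_coordinate[OF ls k(1)])
  \<comment> \<open>\<open>k'\<close> is \<open>- k\<close> and \<open>l'\<close> is
    \<open>r l - k\<close>, both written in the shape \<open>c l + k\<close> of
    \<open>defect_linear\<close> and of the closure of \<open>\<Lambda>\<close>.\<close>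
  define k' where "k' = (\<lambda>x. (\<ominus> \<one>) \<otimes> k x \<oplus> \<zero>)"
  define l' where "l' = (\<lambda>x. r \<otimes> l x \<oplus> k' x)"
  have k'c: "coordinate k'" and "coordinate (\<lambda>x. \<zero>)" using kc by (auto simp: k'_def intro!: coordinateI)
  then have k'd: "defect q k' = (\<ominus> \<one>) \<otimes> defect q k \<oplus> defect q (\<lambda>x. \<zero>)"
    unfolding k'_def using kc by (intro defect_linear[OF assms(1)]) auto
  have l'c: "coordinate l'" using k'c l r(1) by (auto simp: l'_def intro!: coordinateI)
  have "defect q (\<lambda>x. \<zero>) = \<zero>"
    using assms(1) by (auto simp: defect_def)
  with k'd have "defect q k' = \<ominus> (r \<otimes> defect q l)"
    using k r(1) dl by (simp add: R.l_minus)
  then have l'd: "defect q l' = \<zero>"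
    unfolding l'_def using defect_linear[OF assms(1) r(1) l(1) k'c] dl r(1) by (simp add: R.r_neg)
  have "k' \<in> \<Lambda>"
    unfolding k'_def by (rule \<Lambda>(3)[OF _ kc _ ls\<Lambda>[OF k(1)] \<Lambda>(2)]) (auto intro!: coordinateI)
  then have l'\<Lambda>: "l' \<in> \<Lambda>"
    unfolding l'_def using k'c l r(1) by (intro \<Lambda>(3))
  \<comment> \<open>Since \<open>u = h r s\<close>, the head term \<open>h (l x) u\<close> equals
    \<open>h (l' x) s + h (k x) s\<close>, and the second part is absorbed into the tail by
    \<open>S_span_R_span\<close>.\<close>
  define F2 where "F2 = (\<lambda>x. h (k x) \<otimes>\<^bsub>S\<^esub> s \<oplus>\<^bsub>S\<^esub> F1 x)"
  have F2: "F2 \<in> S_span ls" unfolding F2_def by (rule S_span_R_span[OF ls k(1) F(2) r(2)])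
  have "F x = h (l' x) \<otimes>\<^bsub>S\<^esub> s \<oplus>\<^bsub>S\<^esub> F2 x" for x
  proof -
    have "h (l x) \<in> carrier S" "h (k x) \<in> carrier S" "h r \<in> carrier S" using l kc r(1) by auto
    then have "h (l x) \<otimes>\<^bsub>S\<^esub> (h r \<otimes>\<^bsub>S\<^esub> s) \<oplus>\<^bsub>S\<^esub> F1 x =
        (h r \<otimes>\<^bsub>S\<^esub> h (l x) \<oplus>\<^bsub>S\<^esub> (\<ominus>\<^bsub>S\<^esub> \<one>\<^bsub>S\<^esub>) \<otimes>\<^bsub>S\<^esub> h (k x)) \<otimes>\<^bsub>S\<^esub> s \<oplus>\<^bsub>S\<^esub> (h (k x) \<otimes>\<^bsub>S\<^esub> s \<oplus>\<^bsub>S\<^esub> F1 x)"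
      using r(2) F1[of x] by algebra
    then show ?thesis
      using l kc r(1) by (simp add: F(3) r(4) l'_def k'_def F2_def)
  qed
  then have Feq: "F = (\<lambda>x. h (l' x) \<otimes>\<^bsub>S\<^esub> s \<oplus>\<^bsub>S\<^esub> F2 x)" by (rule ext)
  have "S_defect q F = h (defect q l') \<otimes>\<^bsub>S\<^esub> s \<oplus>\<^bsub>S\<^esub> S_defect q F2"
    unfolding Feq by (rule S_defect_linear[OF assms(1) r(2) l'c S_span_closed[OF ls F2]])
  then have "S_defect q F2 = \<zero>\<^bsub>S\<^esub>"
    using Cons.prems(4) l'd r(2) S_defect_in_ext[OF assms(1) ls F2, THEN E.Icarr] by simp
  from Cons.IH[OF _ ls F2 this] Cons.prems(5) obtain ls' where
    ls': "\<forall>l \<in> set ls'. coordinate l \<and> l \<in> \<Lambda> \<and> defect q l = \<zero>" "F2 \<in> S_span ls'"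
    by auto
  show ?case
  proof (rule Cons.prems(1)[of "l' # ls'"])
    show "\<forall>l \<in> set (l' # ls'). coordinate l \<and> l \<in> \<Lambda> \<and> defect q l = \<zero>"
      using ls' l'c l'\<Lambda> l'd by auto
    show "F \<in> S_span (l' # ls')"
      by (rule S_span_ConsI[OF r(2) ls'(2)]) (simp add: Feq)
  qed
qed

text \<open>The relations of \<open>Q\<close> are imposed one at a time. The function
  \<open>F\<close> never changes, only the list that represents it does, so each relation satisfied
  by \<open>F\<close> can still be passed on to the coordinate functions.\<close>

lemma local_linear_lifting:
  assumes "finite Q" "Q \<subseteq> combs" "finite T" "T \<subseteq> carrier S"
  obtains ls F where "\<forall>l \<in> set ls. coordinate l \<and> (\<forall>q \<in> Q. defect q l = \<zero>)" "F \<in> S_span ls"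
    "\<And>t. t \<in> T \<Longrightarrow> F t = t"
proof -
  \<comment> \<open>\<open>F\<close> has to be the identity also at the points occurring in
    \<open>Q\<close>; then every \<open>S_defect q F\<close> vanishes.\<close>
  define T' where "T' = T \<union> comb ` Q \<union> (\<lambda>(a, x, b, y). x) ` Q \<union> (\<lambda>(a, x, b, y). y) ` Q"
  have "finite T'" "T' \<subseteq> carrier S" using assms by (auto simp: T'_def comb_def)
  then obtain ls F where F: "\<forall>l \<in> set ls. coordinate l" "F \<in> S_span ls" "\<And>t. t \<in> T' \<Longrightarrow> F t = t"
    using S_span_identity by metis
  have "\<exists>ls. (\<forall>l \<in> set ls. coordinate l \<and> (\<forall>q \<in> P. defect q l = \<zero>)) \<and> F \<in> S_span ls"
    if "finite P" "P \<subseteq> Q" for P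
    using that
  proof (induction P)
    case empty
    with F show ?case by auto
  next
    case (insert q P)
    then obtain ls where ls: "\<forall>l \<in> set ls. coordinate l \<and> (\<forall>q \<in> P. defect q l = \<zero>)" "F \<in> S_span ls"
      by auto
    obtain a x b y where q: "q = (a, x, b, y)" by (cases q) auto
    have qQ: "q \<in> combs" "q \<in> Q" using insert.prems assms by auto
    have "F (comb q) = comb q" "F x = x" "F y = y"
      using qQ q by (auto intro!: F(3) simp: T'_def image_iff) (metis case_prod_conv)+
    then have defect: "S_defect q F = \<zero>\<^bsub>S\<^esub>"
      using qQ by (simp add: S_defect_def q comb_def S.r_neg S.minus_eq)
    let ?\<Lambda> = "{l. \<forall>q \<in> P. defect q l = \<zero>}"
    have zero: "(\<lambda>x. \<zero>) \<in> ?\<Lambda>" using insert.prems assms by (auto simp: defect_def)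
    have lin: "(\<lambda>x. c \<otimes> l x \<oplus> k x) \<in> ?\<Lambda>"
      if "c \<in> carrier R" "coordinate l" "coordinate k" "l \<in> ?\<Lambda>" "k \<in> ?\<Lambda>" for c l k
    proof -
      have "p \<in> combs" if "p \<in> P" for p using that insert.prems assms by auto
      with that show ?thesis by (simp add: defect_linear)
    qed
    obtain ls' where "\<forall>l \<in> set ls'. coordinate l \<and> l \<in> ?\<Lambda> \<and> defect q l = \<zero>" "F \<in> S_span ls'"
      by (rule S_span_respecting[OF qQ(1) _ ls(2) defect _ zero lin]) (use ls in auto)
    then show ?case by (intro exI[of _ ls']) auto
  qed
  from this[OF assms(1) order_refl] F(3) that show thesis by (auto simp: T'_def)
qed

end

section \<open>Tensor products\<close>

lemma (in ring_hom_cring) restrict_scalars_module: "module R (restrict_scalars S h)"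
proof (rule moduleI)
  show "abelian_group (restrict_scalars S h)"
    by (rule abelian_groupI) (auto simp: S.a_ac intro: bexI[of _ "\<ominus>\<^bsub>S\<^esub> x" for x] S.l_neg)
qed (auto simp: S.l_distr S.r_distr S.m_assoc R.cring_axioms)

lemmas free_Abelian_group_cases [consumes 1, case_names zero diff generator] =
  free_Abelian_group_induct

lemma keys_diff_closed:
  "Poly_Mapping.keys a \<subseteq> A \<Longrightarrow> Poly_Mapping.keys b \<subseteq> A \<Longrightarrow> Poly_Mapping.keys (a - b) \<subseteq> A"
  using keys_diff by fastforce

text \<open>This is the homomorphism \<open>l \<otimes> id\<close> into
  \<open>R \<otimes> N = N\<close>, taken before the relators are divided out, since
  \<open>l\<close> need not be linear.\<close>

definition pairing_map ::
    "('a, 'b, 'm) module_scheme \<Rightarrow> ('a, 'c, 'n) module_scheme \<Rightarrow> ('b \<Rightarrow> 'a) \<Rightarrow> (('b \<times> 'c \<Rightarrow>\<^sub>0 int) \<Rightarrow> 'c) \<Rightarrow> bool"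
  where "pairing_map M N l B \<longleftrightarrow>
    B \<in> hom (free_Abelian_group (carrier M \<times> carrier N)) (add_monoid N) \<and>
    (\<forall>x \<in> carrier M. \<forall>y \<in> carrier N. B (frag_of (x, y)) = l x \<odot>\<^bsub>N\<^esub> y)"

section \<open>Computations modulo the tensor relators\<close>

locale tensor_pair = M: module R M + N: module R N
  for R :: "('a, 'r) ring_scheme" (structure) and M :: "('a, 'b, 'm) module_scheme" and N :: "('a, 'c, 'n) module_scheme"
begin

abbreviation free_pairs :: "('b \<times> 'c \<Rightarrow>\<^sub>0 int) monoid"
  where "free_pairs \<equiv> free_Abelian_group (carrier M \<times> carrier N)"

lemma tensor_relators_closed: "tensor_relators R M N \<subseteq> carrier free_pairs"
proof
  fix z assume "z \<in> tensor_relators R M N"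
  then show "z \<in> carrier free_pairs"
    unfolding tensor_relators_def carrier_free_Abelian_group_iff
    by (elim UnE CollectE exE conjE; hypsubst; intro keys_diff_closed) (simp_all add: keys_frag_of)
qed

lemma tensor_kernel_subgroup: "subgroup (tensor_kernel R M N) free_pairs"
  unfolding tensor_kernel_def
  by (rule group.generate_is_subgroup[OF group_free_Abelian_group tensor_relators_closed])

lemma tensor_kernel_closed: "z \<in> tensor_kernel R M N \<Longrightarrow> Poly_Mapping.keys z \<subseteq> carrier M \<times> carrier N"
  using subsetD[OF subgroup.subset[OF tensor_kernel_subgroup]] by simp

lemma tensor_kernel_zero: "0 \<in> tensor_kernel R M N"
  using subgroup.one_closed[OF tensor_kernel_subgroup] by simp

lemma tensor_kernel_add:
  "a \<in> tensor_kernel R M N \<Longrightarrow> b \<in> tensor_kernel R M N \<Longrightarrow> a + b \<in> tensor_kernel R M N"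
  using subgroup.m_closed[OF tensor_kernel_subgroup] by simp

lemma tensor_kernel_minus:
  assumes "a \<in> tensor_kernel R M N"
  shows "- a \<in> tensor_kernel R M N"
  using subgroup.m_inv_closed[OF tensor_kernel_subgroup assms] tensor_kernel_closed[OF assms] by simp

lemma tensor_kernel_diff:
  "a \<in> tensor_kernel R M N \<Longrightarrow> b \<in> tensor_kernel R M N \<Longrightarrow> a - b \<in> tensor_kernel R M N"
  using tensor_kernel_add[OF _ tensor_kernel_minus] by fastforce

lemma tensor_add_left:
  assumes "x \<in> carrier M" "x' \<in> carrier M" "y \<in> carrier N"
  shows "frag_of (x \<oplus>\<^bsub>M\<^esub> x', y) - frag_of (x, y) - frag_of (x', y) \<in> tensor_kernel R M N"
  unfolding tensor_kernel_def by (rule generate.incl) (use assms in \<open>auto simp: tensor_relators_def\<close>)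

lemma tensor_add_right:
  assumes "x \<in> carrier M" "y \<in> carrier N" "y' \<in> carrier N"
  shows "frag_of (x, y \<oplus>\<^bsub>N\<^esub> y') - frag_of (x, y) - frag_of (x, y') \<in> tensor_kernel R M N"
  unfolding tensor_kernel_def by (rule generate.incl) (use assms in \<open>auto simp: tensor_relators_def\<close>)

lemma tensor_smult:
  assumes "r \<in> carrier R" "x \<in> carrier M" "y \<in> carrier N"
  shows "frag_of (r \<odot>\<^bsub>M\<^esub> x, y) - frag_of (x, r \<odot>\<^bsub>N\<^esub> y) \<in> tensor_kernel R M N"
  unfolding tensor_kernel_def by (rule generate.incl) (use assms in \<open>auto simp: tensor_relators_def\<close>)

text \<open>The additivity relator at two zeros reduces to
  \<open>- frag_of (\<zero>, y)\<close>.\<close>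

lemma tensor_zero_left:
  assumes "y \<in> carrier N"
  shows "frag_of (\<zero>\<^bsub>M\<^esub>, y) \<in> tensor_kernel R M N"
  using tensor_kernel_minus[OF tensor_add_left[of "\<zero>\<^bsub>M\<^esub>" "\<zero>\<^bsub>M\<^esub>" y]] assms by simp

lemma tensor_zero_right:
  assumes "x \<in> carrier M"
  shows "frag_of (x, \<zero>\<^bsub>N\<^esub>) \<in> tensor_kernel R M N"
  using tensor_kernel_minus[OF tensor_add_right[of x "\<zero>\<^bsub>N\<^esub>" "\<zero>\<^bsub>N\<^esub>"]] assms by simp

text \<open>Induction on the free abelian group proceeds by differences, so additivity is wanted in
  subtractive form.\<close>

lemma tensor_diff_right:
  assumes "x \<in> carrier M" "y \<in> carrier N" "y' \<in> carrier N"
  shows "frag_of (x, y) - frag_of (x, y') - frag_of (x, y \<ominus>\<^bsub>N\<^esub> y') \<in> tensor_kernel R M N"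
proof -
  have "y \<ominus>\<^bsub>N\<^esub> y' \<oplus>\<^bsub>N\<^esub> y' = y"
    using assms by (simp add: N.minus_eq N.a_assoc N.l_neg)
  with tensor_add_right[of x "y \<ominus>\<^bsub>N\<^esub> y'" y'] assms show ?thesis
    by (simp add: algebra_simps)
qed

lemma frag_extend_congruent:
  assumes "Poly_Mapping.keys w \<subseteq> carrier M \<times> carrier N"
    "\<And>p. p \<in> carrier M \<times> carrier N \<Longrightarrow> f p - g p \<in> tensor_kernel R M N"
  shows "frag_extend f w - frag_extend g w \<in> tensor_kernel R M N"
  using assms(1)
proof (induction w rule: free_Abelian_group_cases)
  case (diff a b)
  from tensor_kernel_diff[OF diff(3,4)] show ?case
    by (simp add: frag_extend_diff algebra_simps)
qed (auto simp: tensor_kernel_zero assms(2))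

lemma pairing_map_exists:
  assumes "\<And>x. l x \<in> carrier R"
  obtains B where "pairing_map M N l B"
proof -
  have "(\<lambda>(x, y). l x \<odot>\<^bsub>N\<^esub> y) ` (carrier M \<times> carrier N) \<subseteq> carrier (add_monoid N)"
    using assms by auto
  from comm_group.free_Abelian_group_universal[OF N.a_comm_group this] that show ?thesis
    unfolding pairing_map_def by (metis (no_types, lifting) case_prod_conv mem_Sigma_iff)
qed

lemma pairing_map_diff:
  assumes "pairing_map M N l B" "Poly_Mapping.keys a \<subseteq> carrier M \<times> carrier N"
    "Poly_Mapping.keys b \<subseteq> carrier M \<times> carrier N"
  shows "B (a - b) = B a \<ominus>\<^bsub>N\<^esub> B b" "B a \<in> carrier N" "B 0 = \<zero>\<^bsub>N\<^esub>"
proof -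
  interpret B: group_hom free_pairs "add_monoid N" B
    using assms(1) N.a_group by (simp add: group_hom_def group_hom_axioms_def pairing_map_def)
  show "B a \<in> carrier N" using B.hom_closed[of a] assms by simp
  show "B 0 = \<zero>\<^bsub>N\<^esub>" using B.hom_one by simp
  have "B (- b) = \<ominus>\<^bsub>N\<^esub> B b" using B.hom_inv[of b] assms by (simp add: a_inv_def)
  with B.hom_mult[of a "- b"] assms show "B (a - b) = B a \<ominus>\<^bsub>N\<^esub> B b"
    by (simp add: a_minus_def)
qed

lemma pairing_map_of:
  "pairing_map M N l B \<Longrightarrow> x \<in> carrier M \<Longrightarrow> y \<in> carrier N \<Longrightarrow> B (frag_of (x, y)) = l x \<odot>\<^bsub>N\<^esub> y"
  by (simp add: pairing_map_def)

text \<open>In the tensor product this says \<open>\<Sum> u \<otimes> l x_i y_i = u \<otimes>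
  (\<Sum> l x_i y_i)\<close>, and the second factor on the right is the value of
  \<open>B\<close>.\<close>

lemma frag_extend_pairing_map:
  assumes "Poly_Mapping.keys w \<subseteq> carrier M \<times> carrier N" "u \<in> carrier M" "pairing_map M N l B"
  shows "frag_extend (\<lambda>(x, y). frag_of (u, l x \<odot>\<^bsub>N\<^esub> y)) w - frag_of (u, B w) \<in> tensor_kernel R M N"
  using assms(1)
proof (induction w rule: free_Abelian_group_cases)
  case zero
  then show ?case
    using pairing_map_diff(3)[OF assms(3), of 0 0] tensor_kernel_minus[OF tensor_zero_right[OF assms(2)]] by simp
next
  case (diff a b)
  note B = pairing_map_diff[OF assms(3) diff(1,2)] pairing_map_diff(2)[OF assms(3) diff(2,2)]
  let ?e = "frag_extend (\<lambda>(x, y). frag_of (u, l x \<odot>\<^bsub>N\<^esub> y))"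
  have "(?e a - frag_of (u, B a)) - (?e b - frag_of (u, B b)) +
      (frag_of (u, B a) - frag_of (u, B b) - frag_of (u, B a \<ominus>\<^bsub>N\<^esub> B b)) \<in> tensor_kernel R M N"
    by (intro tensor_kernel_add tensor_kernel_diff diff tensor_diff_right assms B)
  then show ?case by (simp add: frag_extend_diff B algebra_simps)
next
  case (generator p)
  then show ?case using assms(3) by (cases p) (simp add: pairing_map_of tensor_kernel_zero)
qed

end

text \<open>
  An element of the tensor kernel is a combination of finitely many relators, so it is killed by
  every coordinate function that is linear where those relators need it to be.
\<close>
lemma (in ring_hom_cring) tensor_kernel_pairing_map:
  assumes "module R N" "z \<in> tensor_kernel R (restrict_scalars S h) N"
  shows "\<exists>Q. finite Q \<and> Q \<subseteq> combs \<and>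
    (\<forall>l B. coordinate l \<longrightarrow> (\<forall>q \<in> Q. defect q l = \<zero>) \<longrightarrow> pairing_map (restrict_scalars S h) N l B \<longrightarrow> B z = \<zero>\<^bsub>N\<^esub>)"
proof -
  interpret N: module R N by fact
  interpret T: tensor_pair R "restrict_scalars S h" N
    by (intro tensor_pair.intro restrict_scalars_module assms)
  have N_cancel: "(a \<oplus>\<^bsub>N\<^esub> b) \<ominus>\<^bsub>N\<^esub> a \<ominus>\<^bsub>N\<^esub> b = \<zero>\<^bsub>N\<^esub>" if "a \<in> carrier N" "b \<in> carrier N" for a b
    using that N.a_comm[of a b] by (simp add: N.minus_eq N.a_assoc N.r_neg)
  let ?good = "\<lambda>z Q. finite Q \<and> Q \<subseteq> combs \<and>
    (\<forall>l B. coordinate l \<longrightarrow> (\<forall>q \<in> Q. defect q l = \<zero>) \<longrightarrow> pairing_map (restrict_scalars S h) N l B \<longrightarrow> B z = \<zero>\<^bsub>N\<^esub>)"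
  have relator: "\<exists>Q. ?good z Q" if "z \<in> tensor_relators R (restrict_scalars S h) N" for z
  proof -
    have eqI: "a = b" if "a \<ominus> b = \<zero>" "a \<in> carrier R" "b \<in> carrier R" for a b
      using that by (simp add: R.r_right_minus_eq)
    from that consider
      (left) x x' y where "x \<in> carrier S" "x' \<in> carrier S" "y \<in> carrier N"
        "z = frag_of (x \<oplus>\<^bsub>S\<^esub> x', y) - frag_of (x, y) - frag_of (x', y)"
      | (right) x y y' where "x \<in> carrier S" "y \<in> carrier N" "y' \<in> carrier N"
        "z = frag_of (x, y \<oplus>\<^bsub>N\<^esub> y') - frag_of (x, y) - frag_of (x, y')"
      | (smult) r x y where "r \<in> carrier R" "x \<in> carrier S" "y \<in> carrier N"
        "z = frag_of (h r \<otimes>\<^bsub>S\<^esub> x, y) - frag_of (x, r \<odot>\<^bsub>N\<^esub> y)"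
      by (auto simp: tensor_relators_def)
    then show ?thesis
    proof cases
      case left
      have "B z = \<zero>\<^bsub>N\<^esub>" if l: "coordinate l" "defect (\<one>, x, \<one>, x') l = \<zero>"
        and B: "pairing_map (restrict_scalars S h) N l B" for l B
      proof -
        have "l (x \<oplus>\<^bsub>S\<^esub> x') = l x \<oplus> l x'"
          by (rule eqI) (use l left in \<open>auto simp: defect_def comb_def\<close>)
        moreover have "Poly_Mapping.keys (frag_of (x \<oplus>\<^bsub>S\<^esub> x', y) - frag_of (x, y)) \<subseteq> carrier S \<times> carrier N"
          by (rule order_trans[OF keys_diff]) (use left in \<open>auto simp: keys_frag_of\<close>)
        ultimately show ?thesis
          using left l T.pairing_map_of[OF B]
          by (simp add: T.pairing_map_diff(1)[OF B] keys_frag_of N.smult_l_distr N_cancel)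
      qed
      with left show ?thesis by (intro exI[of _ "{(\<one>, x, \<one>, x')}"]) auto
    next
      case right
      have "B z = \<zero>\<^bsub>N\<^esub>" if l: "coordinate l"
        and B: "pairing_map (restrict_scalars S h) N l B" for l B
      proof -
        have "Poly_Mapping.keys (frag_of (x, y \<oplus>\<^bsub>N\<^esub> y') - frag_of (x, y)) \<subseteq> carrier S \<times> carrier N"
          by (rule order_trans[OF keys_diff]) (use right in \<open>auto simp: keys_frag_of\<close>)
        then show ?thesis
          using right l T.pairing_map_of[OF B]
          by (simp add: T.pairing_map_diff(1)[OF B] keys_frag_of N.smult_r_distr N_cancel)
      qed
      with right show ?thesis by (intro exI[of _ "{}"]) auto
    next
      case smult
      \<comment> \<open>The tuple \<open>(r, x, \<zero>, x)\<close> writes the scalar relation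
        \<open>l (r x) = r (l x)\<close> in the two-term format, as
        \<open>r x + 0 x\<close>.\<close>
      have "B z = \<zero>\<^bsub>N\<^esub>" if l: "coordinate l" "defect (r, x, \<zero>, x) l = \<zero>"
        and B: "pairing_map (restrict_scalars S h) N l B" for l B
      proof -
        have "l (h r \<otimes>\<^bsub>S\<^esub> x) = r \<otimes> l x"
          by (rule eqI) (use l smult in \<open>auto simp: defect_def comb_def\<close>)
        also have "\<dots> = l x \<otimes> r"
          using l smult by (simp add: R.m_comm)
        finally show ?thesis
          using smult l T.pairing_map_of[OF B]
          by (simp add: T.pairing_map_diff(1)[OF B] keys_frag_of N.smult_assoc1 N.minus_eq N.r_neg)
      qed
      with smult show ?thesis by (intro exI[of _ "{(r, x, \<zero>, x)}"]) auto
    qed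
  qed
  have diff: "\<exists>Q. ?good (a - b) Q" if "\<exists>Q. ?good a Q" "\<exists>Q. ?good b Q"
    "Poly_Mapping.keys a \<subseteq> carrier S \<times> carrier N" "Poly_Mapping.keys b \<subseteq> carrier S \<times> carrier N" for a b
  proof -
    from that(1,2) obtain Q Q' where Q: "?good a Q" "?good b Q'" by blast
    have "B (a - b) = \<zero>\<^bsub>N\<^esub>"
      if "coordinate l" "\<forall>q \<in> Q \<union> Q'. defect q l = \<zero>" and B: "pairing_map (restrict_scalars S h) N l B" for l B
    proof -
      have "B a = \<zero>\<^bsub>N\<^esub>" "B b = \<zero>\<^bsub>N\<^esub>" using Q that by blast+
      then show ?thesis
        using T.pairing_map_diff(1)[OF B, of a b] \<open>Poly_Mapping.keys a \<subseteq> _\<close> \<open>Poly_Mapping.keys b \<subseteq> _\<close>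
        by (simp add: N.minus_eq N.r_neg)
    qed
    with Q show ?thesis by (intro exI[of _ "Q \<union> Q'"]) simp
  qed
  have zero: "\<exists>Q. ?good 0 Q"
    by (intro exI[of _ "{}"]) (use T.pairing_map_diff(3)[of _ _ 0 0] in auto)
  have closed: "Poly_Mapping.keys w \<subseteq> carrier S \<times> carrier N"
    if "w \<in> generate (free_Abelian_group (carrier S \<times> carrier N)) (tensor_relators R (restrict_scalars S h) N)" for w
    using T.tensor_kernel_closed[of w] that by (simp add: tensor_kernel_def)
  show ?thesis
    using assms(2) unfolding tensor_kernel_def restrict_scalars_simps
  proof (induction z rule: generate.induct)
    case one
    then show ?case using zero by simp
  next
    case (incl w)
    then show ?case by (rule relator)
  next
    case (inv w)
    have "Poly_Mapping.keys w \<subseteq> carrier S \<times> carrier N" by (rule closed[OF generate.incl[OF inv]])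
    with diff[OF zero relator[OF inv]] show ?case by simp
  next
    case (eng v w)
    note keys = closed[OF eng(1)] closed[OF eng(2)]
    \<comment> \<open>A sum is treated as the difference \<open>v - (0 - w)\<close>, so that
      \<open>diff\<close> covers both inverses and sums.\<close>
    have "\<exists>Q. ?good (0 - w) Q" using diff[OF zero eng(4)] keys by simp
    from diff[OF eng(3) this] keys show ?case by simp
  qed
qed

text \<open>Moving the values \<open>l x\<close> across the tensor sign turns
  \<open>\<Sum> F x_i \<otimes> y_i\<close> into a sum of terms \<open>u \<otimes> B w\<close>, one
  for each coordinate function, and every \<open>B w\<close> is zero.\<close>

lemma (in ring_hom_cring) frag_extend_S_span:
  assumes "module R N" "\<forall>l \<in> set ls. coordinate l" "F \<in> S_span ls"
    "Poly_Mapping.keys w \<subseteq> carrier S \<times> carrier N"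
    "\<And>l B. l \<in> set ls \<Longrightarrow> pairing_map (restrict_scalars S h) N l B \<Longrightarrow> B w = \<zero>\<^bsub>N\<^esub>"
  shows "frag_extend (\<lambda>(x, y). frag_of (F x, y)) w \<in> tensor_kernel R (restrict_scalars S h) N"
proof -
  interpret N: module R N by fact
  interpret T: tensor_pair R "restrict_scalars S h" N
    by (intro tensor_pair.intro restrict_scalars_module assms)
  let ?K = "tensor_kernel R (restrict_scalars S h) N"
  have w: "Poly_Mapping.keys w \<subseteq> carrier (restrict_scalars S h) \<times> carrier N" using assms(4) by simp
  show ?thesis
    using assms(2,3,5)
  proof (induction ls arbitrary: F)
    case Nil
    then show ?case
      using T.frag_extend_congruent[OF w, of "\<lambda>(x, y). frag_of (F x, y)" "\<lambda>p. 0"]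
      by (auto simp: frag_extend_eq_0 T.tensor_zero_left[simplified])
  next
    case (Cons l ls)
    then obtain u F1 where F: "u \<in> carrier S" "F1 \<in> S_span ls" "F = (\<lambda>x. h (l x) \<otimes>\<^bsub>S\<^esub> u \<oplus>\<^bsub>S\<^esub> F1 x)"
      by auto
    have l: "coordinate l" using Cons.prems by auto
    then obtain B where B: "pairing_map (restrict_scalars S h) N l B"
      using T.pairing_map_exists[of l] by auto
    have F1: "F1 x \<in> carrier S" for x using S_span_closed[of ls F1] F Cons.prems by auto
    let ?v = "frag_extend (\<lambda>(x, y). frag_of (u, l x \<odot>\<^bsub>N\<^esub> y)) w"
    let ?F1 = "frag_extend (\<lambda>(x, y). frag_of (F1 x, y)) w"
    have 1: "?F1 \<in> ?K" using Cons F by auto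
    have "?v - frag_of (u, B w) \<in> ?K"
      by (rule T.frag_extend_pairing_map[OF w _ B]) (use F in simp)
    moreover have "frag_of (u, B w) \<in> ?K"
      using Cons.prems(3)[OF _ B] F T.tensor_zero_right[of u] by simp
    ultimately have 2: "?v \<in> ?K" using T.tensor_kernel_add by fastforce
    have "frag_extend (\<lambda>(x, y). frag_of (F x, y)) w - frag_extend (\<lambda>(x, y). frag_of (u, l x \<odot>\<^bsub>N\<^esub> y) + frag_of (F1 x, y)) w \<in> ?K"
    proof (rule T.frag_extend_congruent[OF w], clarsimp)
      fix x y assume xy: "x \<in> carrier S" "y \<in> carrier N"
      have "(frag_of (h (l x) \<otimes>\<^bsub>S\<^esub> u \<oplus>\<^bsub>S\<^esub> F1 x, y) - frag_of (h (l x) \<otimes>\<^bsub>S\<^esub> u, y) - frag_of (F1 x, y)) +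
          (frag_of (h (l x) \<otimes>\<^bsub>S\<^esub> u, y) - frag_of (u, l x \<odot>\<^bsub>N\<^esub> y)) \<in> ?K"
        using l F F1 xy by (intro T.tensor_kernel_add T.tensor_add_left[simplified] T.tensor_smult[simplified]) auto
      then show "frag_of (F x, y) - (frag_of (u, l x \<odot>\<^bsub>N\<^esub> y) + frag_of (F1 x, y)) \<in> ?K"
        by (simp add: F(3) algebra_simps)
    qed
    moreover have "frag_extend (\<lambda>(x, y). frag_of (u, l x \<odot>\<^bsub>N\<^esub> y) + frag_of (F1 x, y)) w = ?v + ?F1"
      by (simp add: frag_extend_def frag_cmul_distrib2 sum.distrib case_prod_beta)
    ultimately show ?case
      using T.tensor_kernel_add[OF _ T.tensor_kernel_add[OF 2 1]] by fastforce
  qed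
qed

section \<open>Faithful flatness\<close>

context principally_extended
begin

text \<open>The vanishing of the image of \<open>w\<close> involves finitely many relators. For
  coordinate functions respecting them, the pairing with the image is zero and equals
  \<open>f (B w)\<close>, so \<open>B w\<close> is zero as \<open>f\<close> is injective. Since
  \<open>F\<close> fixes all first components of \<open>w\<close>, \<open>frag_extend_S_span\<close>
  then shows that \<open>w\<close> itself represents zero.\<close>

lemma tensor_kernel_reflect:
  assumes "module R N" "module R N'" "f \<in> module_hom R N N'" "inj_on f (carrier N)"
    and w: "Poly_Mapping.keys w \<subseteq> carrier S \<times> carrier N"
    and z: "frag_extend (\<lambda>(x, y). frag_of (x, f y)) w \<in> tensor_kernel R (restrict_scalars S h) N'"
  shows "w \<in> tensor_kernel R (restrict_scalars S h) N"
proof -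
  interpret N: module R N by fact
  interpret N': module R N' by fact
  interpret T: tensor_pair R "restrict_scalars S h" N
    by (intro tensor_pair.intro restrict_scalars_module assms)
  interpret T': tensor_pair R "restrict_scalars S h" N'
    by (intro tensor_pair.intro restrict_scalars_module assms)
  have f: "f y \<in> carrier N'" "f (y \<oplus>\<^bsub>N\<^esub> y') = f y \<oplus>\<^bsub>N'\<^esub> f y'"
    if "y \<in> carrier N" "y' \<in> carrier N" for y y'
    using that assms(3) by (auto simp: module_hom_def)
  have f_smult: "f (r \<odot>\<^bsub>N\<^esub> y) = r \<odot>\<^bsub>N'\<^esub> f y" if "r \<in> carrier R" "y \<in> carrier N" for r y
    using that assms(3) by (auto simp: module_hom_def)
  interpret f: abelian_group_hom N N' f
    by (intro abelian_group_homI N.abelian_group_axioms N'.abelian_group_axioms)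
      (use f in \<open>auto simp: group_hom_def group_hom_axioms_def hom_def N.a_group N'.a_group\<close>)
  obtain Q where Q: "finite Q" "Q \<subseteq> combs"
    "\<forall>l B. coordinate l \<longrightarrow> (\<forall>q \<in> Q. defect q l = \<zero>) \<longrightarrow> pairing_map (restrict_scalars S h) N' l B \<longrightarrow>
      B (frag_extend (\<lambda>(x, y). frag_of (x, f y)) w) = \<zero>\<^bsub>N'\<^esub>"
    using tensor_kernel_pairing_map[OF assms(2) z] by blast
  obtain ls F where F: "\<forall>l \<in> set ls. coordinate l \<and> (\<forall>q \<in> Q. defect q l = \<zero>)" "F \<in> S_span ls"
    "\<And>t. t \<in> fst ` Poly_Mapping.keys w \<Longrightarrow> F t = t"
    by (rule local_linear_lifting[OF Q(1,2), of "fst ` Poly_Mapping.keys w"]) (use w in auto)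
  have "frag_extend (\<lambda>(x, y). frag_of (F x, y)) w \<in> tensor_kernel R (restrict_scalars S h) N"
  proof (rule frag_extend_S_span[OF assms(1) _ F(2) w])
    fix l B assume l: "l \<in> set ls" and B: "pairing_map (restrict_scalars S h) N l B"
    have lc: "coordinate l" using F l by auto
    then obtain B' where B': "pairing_map (restrict_scalars S h) N' l B'"
      using T'.pairing_map_exists[of l] by auto
    have keys': "Poly_Mapping.keys (frag_extend (\<lambda>(x, y). frag_of (x, f y)) v) \<subseteq> carrier S \<times> carrier N'"
      if "Poly_Mapping.keys v \<subseteq> carrier S \<times> carrier N" for v
      by (rule order_trans[OF keys_frag_extend]) (use that f(1) in \<open>force simp: keys_frag_of\<close>)
    have "B' (frag_extend (\<lambda>(x, y). frag_of (x, f y)) w) = f (B w)"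
      using w
    proof (induction w rule: free_Abelian_group_cases)
      case zero
      show ?case using T'.pairing_map_diff(3)[OF B', of 0 0] T.pairing_map_diff(3)[OF B, of 0 0] by simp
    next
      case (diff a b)
      note BB = T.pairing_map_diff[OF B, simplified, OF diff(1,2)] T.pairing_map_diff(2)[OF B, simplified, OF diff(2,2)]
      show ?case
        using BB diff(3,4) T'.pairing_map_diff(1)[OF B', simplified, OF keys'[OF diff(1)] keys'[OF diff(2)]]
        by (simp add: frag_extend_diff N.minus_eq N'.minus_eq)
    next
      case (generator p)
      then show ?case
        using f_smult lc by (cases p) (simp add: T.pairing_map_of[OF B] T'.pairing_map_of[OF B'])
    qed
    then have "f (B w) = f \<zero>\<^bsub>N\<^esub>" using Q(3) lc B' F l by auto
    moreover have "B w \<in> carrier N" using T.pairing_map_diff(2)[OF B] w by simp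
    ultimately show "B w = \<zero>\<^bsub>N\<^esub>" by (rule inj_onD[OF assms(4)]) simp
  qed (use F in auto)
  moreover have "frag_extend (\<lambda>(x, y). frag_of (F x, y)) w = frag_extend frag_of w"
    by (rule frag_extend_eq) (auto simp: F(3) rev_image_eqI)
  ultimately show ?thesis by (simp flip: frag_expansion)
qed

lemma is_flat: "flat T R (restrict_scalars S h)"
  unfolding flat_def
proof (intro allI impI, elim conjE)
  fix N N' :: "('a, 'e) module" and f
  assume N: "module R N" "module R N'" "f \<in> module_hom R N N'" "inj_on f (carrier N)"
  interpret N: module R N by fact
  interpret T: tensor_pair R "restrict_scalars S h" N
    by (intro tensor_pair.intro restrict_scalars_module N)
  interpret T': tensor_pair R "restrict_scalars S h" N'
    by (intro tensor_pair.intro restrict_scalars_module N)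
  let ?K = "tensor_kernel R (restrict_scalars S h) N"
  let ?K' = "tensor_kernel R (restrict_scalars S h) N'"
  let ?f = "frag_extend (\<lambda>(x, y). frag_of (x, f y))"
  interpret K: subgroup ?K T.free_pairs by (rule T.tensor_kernel_subgroup)
  interpret G: group T.free_pairs by simp
  show "inj_on (tensor_map R (restrict_scalars S h) N' f) (carrier (tensor_product R (restrict_scalars S h) N))"
  proof (rule inj_onI)
    fix C D
    assume C: "C \<in> carrier (tensor_product R (restrict_scalars S h) N)"
      and D: "D \<in> carrier (tensor_product R (restrict_scalars S h) N)"
      and eq: "tensor_map R (restrict_scalars S h) N' f C = tensor_map R (restrict_scalars S h) N' f D"
    obtain c where c: "c \<in> carrier T.free_pairs" "C = ?K #>\<^bsub>T.free_pairs\<^esub> c"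
      using C by (auto simp: tensor_product_def carrier_FactGroup)
    obtain d where d: "d \<in> carrier T.free_pairs" "D = ?K #>\<^bsub>T.free_pairs\<^esub> d"
      using D by (auto simp: tensor_product_def carrier_FactGroup)
    \<comment> \<open>Equality of the image cosets is read off at one representative: the image of
      \<open>c\<close> differs from the image of some \<open>b \<in> D\<close> by an element of
      \<open>?K'\<close>, and \<open>tensor_kernel_reflect\<close> puts \<open>c - b\<close> into
      \<open>?K\<close>.\<close>
    have "c \<in> C" using c G.rcos_self[OF c(1) K.subgroup_axioms] by simp
    then have "0 + ?f c \<in> tensor_map R (restrict_scalars S h) N' f C"
      unfolding tensor_map_def set_mult_def using T'.tensor_kernel_zero by fastforce
    then have "0 + ?f c \<in> tensor_map R (restrict_scalars S h) N' f D" by (simp only: eq)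
    then obtain k b where k: "k \<in> ?K'" "b \<in> D" "?f c = k + ?f b"
      unfolding tensor_map_def set_mult_def by auto
    have b: "b \<in> carrier T.free_pairs" using k(2) d K.elemrcos_carrier[OF G.is_group] by blast
    have "c - b \<in> ?K"
    proof (rule tensor_kernel_reflect[OF N])
      show "Poly_Mapping.keys (c - b) \<subseteq> carrier S \<times> carrier N"
        by (rule order_trans[OF keys_diff]) (use b c in auto)
      show "?f (c - b) \<in> ?K'" using k by (simp add: frag_extend_diff)
    qed
    moreover have "D = ?K #>\<^bsub>T.free_pairs\<^esub> b"
      using G.repr_independence[OF _ d(1) K.subgroup_axioms] k(2) d(2) by simp
    ultimately have "c \<in> D"
      unfolding r_coset_def by (auto intro!: bexI[of _ "c - b"])
    then show "C = D"
      using G.repr_independence[OF _ d(1) K.subgroup_axioms] c(2) d(2) by simp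
  qed
qed

text \<open>Every \<open>1 \<otimes> n\<close> is zero, so \<open>1\<close> is a combination of
  elements \<open>h (l 1)\<close> with \<open>l 1\<close> in the annihilator of \<open>n\<close>.
  Contraction returns \<open>1\<close> to the annihilator, which means \<open>n = 0\<close>.\<close>

lemma is_faithfully_flat: "faithfully_flat T R (restrict_scalars S h)"
  unfolding faithfully_flat_def
proof (intro conjI is_flat allI impI, elim conjE)
  fix N :: "('a, 'e) module"
  assume N: "module R N" and trivial: "trivial_group (tensor_product R (restrict_scalars S h) N)"
  interpret N: module R N by fact
  interpret T: tensor_pair R "restrict_scalars S h" N
    by (intro tensor_pair.intro restrict_scalars_module N)
  let ?K = "tensor_kernel R (restrict_scalars S h) N"
  interpret K: subgroup ?K T.free_pairs by (rule T.tensor_kernel_subgroup)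
  interpret G: group T.free_pairs by simp
  have "n = \<zero>\<^bsub>N\<^esub>" if n: "n \<in> carrier N" for n
  proof -
    let ?w = "frag_of (\<one>\<^bsub>S\<^esub>, n)"
    have w: "?w \<in> carrier T.free_pairs" using n by simp
    then have "?K #>\<^bsub>T.free_pairs\<^esub> ?w = ?K"
      using trivial by (auto simp: tensor_product_def trivial_group_def carrier_FactGroup)
    with G.rcos_self[OF w K.subgroup_axioms] have wK: "?w \<in> ?K" by simp
    obtain Q where Q: "finite Q" "Q \<subseteq> combs"
      "\<forall>l B. coordinate l \<longrightarrow> (\<forall>q \<in> Q. defect q l = \<zero>) \<longrightarrow> pairing_map (restrict_scalars S h) N l B \<longrightarrow> B ?w = \<zero>\<^bsub>N\<^esub>"
      using tensor_kernel_pairing_map[OF N wK] by blast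
    obtain ls F where F: "\<forall>l \<in> set ls. coordinate l \<and> (\<forall>q \<in> Q. defect q l = \<zero>)" "F \<in> S_span ls"
      "\<And>t. t \<in> {\<one>\<^bsub>S\<^esub>} \<Longrightarrow> F t = t"
      by (rule local_linear_lifting[OF Q(1,2), of "{\<one>\<^bsub>S\<^esub>}"]) auto
    let ?A = "{r \<in> carrier R. r \<odot>\<^bsub>N\<^esub> n = \<zero>\<^bsub>N\<^esub>}"
    have A: "ideal ?A R"
    proof (rule idealI, rule R.ring_axioms)
      show "subgroup ?A (add_monoid R)"
        by unfold_locales (use n in \<open>auto simp: N.smult_l_distr N.smult_l_minus simp flip: a_inv_def\<close>)
      show "x \<otimes> a \<in> ?A" if "a \<in> ?A" "x \<in> carrier R" for a x
        using that n by (simp add: N.smult_assoc1)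
      then show "a \<otimes> x \<in> ?A" if "a \<in> ?A" "x \<in> carrier R" for a x
        using that by (metis (no_types, lifting) R.m_comm mem_Collect_eq)
    qed
    interpret E: ideal "ext ?A" S by (rule ext_ideal[OF A])
    have "l \<one>\<^bsub>S\<^esub> \<in> ?A" if l: "l \<in> set ls" for l
    proof -
      have lc: "coordinate l" using F l by auto
      then obtain B where B: "pairing_map (restrict_scalars S h) N l B"
        using T.pairing_map_exists[of l] by auto
      then have "B ?w = \<zero>\<^bsub>N\<^esub>" using Q(3) lc F l by auto
      then show ?thesis using T.pairing_map_of[OF B] n lc by simp
    qed
    with F(2) have "F \<one>\<^bsub>S\<^esub> \<in> ext ?A"
      by (induction ls arbitrary: F) (auto intro!: ext_add ext_mult)
    then have "h \<one> \<in> ext ?A" using F(3) by simp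
    from contraction[OF A R.one_closed this] n show ?thesis by simp
  qed
  then show "carrier N = {\<zero>\<^bsub>N\<^esub>}" by auto
qed

lemma is_gaussian: "gaussian T R S h"
  unfolding gaussian_def using is_ohm_rush is_faithfully_flat content_mult by auto

end

section \<open>Noetherian local rings\<close>

lemma (in ring) set_add_memI: "a \<in> A \<Longrightarrow> b \<in> B \<Longrightarrow> a \<oplus> b \<in> A <+>\<^bsub>R\<^esub> B"
  unfolding set_add_def' by blast

lemma (in ring) ideal_subset_set_add:
  assumes "ideal I R" "ideal J R"
  shows "I \<subseteq> I <+>\<^bsub>R\<^esub> J" "J \<subseteq> I <+>\<^bsub>R\<^esub> J"
proof -
  interpret I: ideal I R by fact
  interpret J: ideal J R by fact
  show "I \<subseteq> I <+>\<^bsub>R\<^esub> J" using set_add_memI[OF _ J.zero_closed] I.Icarr by fastforce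
  show "J \<subseteq> I <+>\<^bsub>R\<^esub> J" using set_add_memI[OF I.zero_closed] J.Icarr by fastforce
qed

lemma (in cring) ideals_monoid: "monoid (ideals_set R)"
  using ideals_set_is_comm_monoid by (simp add: comm_monoid_def)

lemma ideals_set_simps [simp]:
  "carrier (ideals_set R) = {I. ideal I R}"
  "\<one>\<^bsub>ideals_set R\<^esub> = carrier R"
  "I \<otimes>\<^bsub>ideals_set R\<^esub> J = I \<cdot>\<^bsub>R\<^esub> J"
  by (simp_all add: ideals_set_def)

lemma (in cring) ideal_power_ideal: "ideal I R \<Longrightarrow> ideal (ideal_power R I n) R"
  by (induction n) (simp_all add: oneideal ideal_prod_is_ideal)

lemma (in cring) ideal_power_add:
  "ideal I R \<Longrightarrow> ideal_power R I (m + n) = ideal_power R I m \<cdot> ideal_power R I n"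
  using monoid.nat_pow_mult[OF ideals_monoid, of I m n] by (simp add: ideals_set_def)

lemma (in cring) ideal_power_decreasing:
  assumes "ideal I R" "m \<le> n"
  shows "ideal_power R I n \<subseteq> ideal_power R I m"
  using assms(2)
proof (induction rule: dec_induct)
  case (step n)
  then show ?case
    using ideal_prod_inter[OF ideal_power_ideal[OF assms(1)] assms(1), of n] by auto
qed simp

lemma ideal_prod_mono:
  assumes "I \<subseteq> I'" "J \<subseteq> J'"
  shows "I \<cdot>\<^bsub>R\<^esub> J \<subseteq> I' \<cdot>\<^bsub>R\<^esub> J'"
proof
  fix x assume "x \<in> I \<cdot>\<^bsub>R\<^esub> J"
  then show "x \<in> I' \<cdot>\<^bsub>R\<^esub> J'"
    by (induction rule: ideal_prod.induct) (use assms in \<open>auto intro: ideal_prod.intros\<close>)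
qed

lemma (in cring) mem_ideal_prod_PIdl:
  assumes "ideal I R" "x \<in> carrier R" "z \<in> I \<cdot> (PIdl x)"
  obtains e where "e \<in> I" "z = e \<otimes> x"
proof -
  interpret I: ideal I R by fact
  from assms(3) have "\<exists>e \<in> I. z = e \<otimes> x"
  proof (induction rule: ideal_prod.induct)
    case (prod i j)
    then obtain r where "r \<in> carrier R" "j = r \<otimes> x" by (auto simp: cgenideal_def)
    with prod assms(2) I.Icarr show ?case
      by (intro bexI[of _ "i \<otimes> r"]) (simp_all add: m_assoc I.I_r_closed)
  next
    case (sum s t)
    then obtain e f where "e \<in> I" "f \<in> I" "s = e \<otimes> x" "t = f \<otimes> x" by auto
    with assms(2) I.Icarr show ?case
      by (intro bexI[of _ "e \<oplus> f"]) (simp_all add: l_distr)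
  qed
  with that show thesis by blast
qed

text \<open>In a Noetherian ring the union of a nonempty chain of ideals is a member of the chain,
  so Zorn's lemma applies to any nonempty family of ideals.\<close>

lemma (in noetherian_ring) maximal_ideal_exists:
  assumes "\<C> \<noteq> {}" "\<And>I. I \<in> \<C> \<Longrightarrow> ideal I R"
  obtains K where "K \<in> \<C>" "\<And>I. I \<in> \<C> \<Longrightarrow> K \<subseteq> I \<Longrightarrow> I = K"
proof -
  have "\<Union>C \<in> \<C>" if "C \<noteq> {}" "subset.chain \<C> C" for C
  proof -
    have "subset.chain {I. ideal I R} C"
      using that(2) assms(2) by (auto simp: subset.chain_def)
    with ideal_chain_is_trivial[OF that(1)] that(2) show ?thesis
      by (auto simp: subset.chain_def)
  qed
  from subset_Zorn_nonempty[OF assms(1) this] that show thesis by metis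
qed

section \<open>Units, Krull's intersection theorem and Nakayama's lemma\<close>

locale noetherian_local = cring R for R (structure) +
  fixes \<mm>
  assumes noetherian: "noetherian_ring R"
    and maximal: "maximalideal \<mm> R"
    and unique_maximal: "maximalideal I R \<Longrightarrow> I = \<mm>"
begin

lemma mm_ideal: "ideal \<mm> R"
  using maximal by (rule maximalideal.axioms)

sublocale \<mm>: ideal \<mm> R
  by (rule mm_ideal)

lemma one_notin_mm: "\<one> \<notin> \<mm>"
  using \<mm>.one_imp_carrier maximalideal.I_notcarr[OF maximal] by auto

text \<open>An ideal that is maximal among those containing \<open>I\<close> and avoiding
  \<open>\<one>\<close> is a maximal ideal, hence equal to \<open>\<mm>\<close>.\<close>

lemma proper_ideal_subset_mm:
  assumes "ideal I R" "\<one> \<notin> I"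
  shows "I \<subseteq> \<mm>"
proof -
  interpret noetherian_ring R by (rule noetherian)
  obtain K where K: "K \<in> {K. ideal K R \<and> I \<subseteq> K \<and> \<one> \<notin> K}"
    and max: "\<And>J. J \<in> {K. ideal K R \<and> I \<subseteq> K \<and> \<one> \<notin> K} \<Longrightarrow> K \<subseteq> J \<Longrightarrow> J = K"
    by (rule maximal_ideal_exists[of "{K. ideal K R \<and> I \<subseteq> K \<and> \<one> \<notin> K}"]) (use assms in auto)
  have "maximalideal K R"
  proof (rule maximalidealI)
    show "carrier R \<noteq> K" using K by auto
    show "J = K \<or> J = carrier R" if "ideal J R" "K \<subseteq> J" "J \<subseteq> carrier R" for J
    proof (cases "\<one> \<in> J")
      case True
      with ideal.one_imp_carrier[OF that(1)] show ?thesis by simp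
    next
      case False
      with that K max[of J] show ?thesis by auto
    qed
  qed (use K in simp)
  with unique_maximal K show ?thesis by blast
qed

lemma unit_outside_mm:
  assumes "r \<in> carrier R" "r \<notin> \<mm>"
  shows "r \<in> Units R"
proof -
  have "\<one> \<in> PIdl r"
    using proper_ideal_subset_mm[OF cgenideal_ideal[OF assms(1)]] cgenideal_self[OF assms(1)] assms(2) by blast
  then obtain s where "s \<in> carrier R" "\<one> = s \<otimes> r" by (auto simp: cgenideal_def)
  with assms(1) show ?thesis by (auto simp: Units_def m_comm intro!: bexI[of _ s])
qed

lemma one_minus_unit:
  assumes "e \<in> \<mm>"
  shows "\<one> \<ominus> e \<in> Units R"
proof (rule unit_outside_mm)
  show "\<one> \<ominus> e \<notin> \<mm>"
  proof
    assume "\<one> \<ominus> e \<in> \<mm>"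
    then have "(\<one> \<ominus> e) \<oplus> e \<in> \<mm>" using assms by simp
    moreover have "(\<one> \<ominus> e) \<oplus> e = \<one>"
      using \<mm>.Icarr[OF assms] by (simp add: minus_eq a_assoc l_neg)
    ultimately show False using one_notin_mm by simp
  qed
qed (use \<mm>.Icarr[OF assms] in simp)

text \<open>
  Otherwise take \<open>K\<close> maximal without a power of \<open>\<mm>\<close> in it. Then some \<open>b \<in> \<mm> - K\<close> has \<open>b\<^sup>2 \<in> K\<close>, and a power
  of \<open>\<mm>\<close> lies in \<open>K + bR\<close>, whose square lies in \<open>K\<close>.
\<close>
lemma power_mm_subset:
  assumes "ideal K R" "\<And>y. y \<in> \<mm> \<Longrightarrow> \<exists>j::nat. y [^] j \<in> K"
  obtains n where "ideal_power R \<mm> n \<subseteq> K"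
proof (rule ccontr)
  assume "\<not> thesis"
  interpret noetherian_ring R by (rule noetherian)
  let ?C = "{L. ideal L R \<and> K \<subseteq> L \<and> (\<forall>n. \<not> ideal_power R \<mm> n \<subseteq> L)}"
  have "K \<in> ?C" using that assms(1) \<open>\<not> thesis\<close> by auto
  then obtain L where L: "L \<in> ?C" and max: "\<And>J. J \<in> ?C \<Longrightarrow> L \<subseteq> J \<Longrightarrow> J = L"
    by (rule_tac maximal_ideal_exists[of ?C]) auto
  interpret L: ideal L R using L by simp
  have "ideal_power R \<mm> 1 = \<mm>"
    using ideal_prod_one[OF mm_ideal] ideal_prod_commute[OF mm_ideal oneideal] by simp
  moreover have "\<not> ideal_power R \<mm> 1 \<subseteq> L" using L by blast
  ultimately obtain a where a: "a \<in> \<mm>" "a \<notin> L" by auto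
  have ac: "a \<in> carrier R" using a by simp
  define j where "j = (LEAST j::nat. a [^] j \<in> L)"
  have "\<exists>j::nat. a [^] j \<in> L" using assms(2)[OF a(1)] L by auto
  then have j: "a [^] j \<in> L" unfolding j_def by (rule LeastI_ex)
  have least: "a [^] i \<notin> L" if "i < j" for i
    using that not_less_Least unfolding j_def by blast
  have "j \<noteq> 0"
  proof
    assume "j = 0"
    with j have "L = carrier R" using L.one_imp_carrier by simp
    then show False using a ac by simp
  qed
  moreover have "j \<noteq> 1" using j a ac by auto
  ultimately obtain i where i: "j = Suc (Suc i)" by (metis One_nat_def not0_implies_Suc)
  \<comment> \<open>With \<open>j = i + 2\<close> minimal, \<open>b = a^(j-1)\<close> is still
    outside \<open>L\<close>, while \<open>b \<otimes> b = a^i a^j\<close> lies in it.\<close>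
  define b where "b = a [^] Suc i"
  have b: "b \<in> carrier R" "b \<notin> L" using ac least[of "Suc i"] i by (auto simp: b_def)
  have "b \<otimes> b = a [^] i \<otimes> a [^] j"
    using ac by (simp add: b_def i m_ac)
  then have bb: "b \<otimes> b \<in> L" using L.I_l_closed[OF j] ac by simp
  let ?J = "L <+>\<^bsub>R\<^esub> PIdl b"
  have J: "ideal ?J R" by (intro add_ideals L.is_ideal cgenideal_ideal b)
  have LJ: "L \<subseteq> ?J" and bJ: "b \<in> ?J"
    using ideal_subset_set_add[OF L.is_ideal cgenideal_ideal[OF b(1)]] cgenideal_self[OF b(1)] by auto
  have "?J \<notin> ?C" using max[OF _ LJ] bJ b by auto
  then obtain n where n: "ideal_power R \<mm> n \<subseteq> ?J" using J LJ L by auto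
  have "ideal_power R \<mm> (n + n) \<subseteq> L"
    unfolding ideal_power_add[OF mm_ideal]
  proof
    fix z assume "z \<in> ideal_power R \<mm> n \<cdot> ideal_power R \<mm> n"
    then show "z \<in> L"
    proof (induction rule: ideal_prod.induct)
      case (prod u v)
      then have "u \<in> ?J" "v \<in> ?J" using n by auto
      then obtain k r l s where "k \<in> L" "l \<in> L" "r \<in> carrier R" "s \<in> carrier R"
        "u = k \<oplus> r \<otimes> b" "v = l \<oplus> s \<otimes> b"
        unfolding set_add_def' cgenideal_def by blast
      moreover from this have "k \<in> carrier R" "l \<in> carrier R" by auto
      ultimately have "u \<otimes> v = v \<otimes> k \<oplus> (r \<otimes> b) \<otimes> l \<oplus> (r \<otimes> s) \<otimes> (b \<otimes> b)"
        and "v \<in> carrier R"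
        using b by (simp_all, algebra)
      with bb b \<open>k \<in> L\<close> \<open>l \<in> L\<close> \<open>r \<in> _\<close> \<open>s \<in> _\<close> show ?case
        by (simp add: L.I_l_closed)
    qed auto
  qed
  with L show False by blast
qed

text \<open>
  Let \<open>J = I + \<mm>x\<close> and take \<open>K \<supseteq> J\<close> maximal with \<open>K \<inter> (I + Rx) \<subseteq> J\<close>. For \<open>y \<in> \<mm>\<close> the chain of the
  colon ideals \<open>K : y\<^sup>j\<close> becomes stationary, and from there on \<open>K + y\<^sup>jR\<close> still meets \<open>I + Rx\<close> inside \<open>J\<close>.
  So \<open>K\<close> contains a power of each such \<open>y\<close>, hence a power of \<open>\<mm>\<close>, hence \<open>x\<close>; thus \<open>x \<in> J\<close>.
\<close>
lemma krull_intersection: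
  assumes "ideal I R" "x \<in> carrier R" "\<And>n. x \<in> I <+>\<^bsub>R\<^esub> ideal_power R \<mm> n"
  shows "x \<in> I"
proof -
  interpret noetherian_ring R by (rule noetherian)
  interpret I: ideal I R by fact
  define L where "L = I <+>\<^bsub>R\<^esub> PIdl x"
  define J where "J = I <+>\<^bsub>R\<^esub> (\<mm> \<cdot> (PIdl x))"
  have x: "ideal (PIdl x) R" by (rule cgenideal_ideal[OF assms(2)])
  have mx: "ideal (\<mm> \<cdot> (PIdl x)) R" by (rule ideal_prod_is_ideal[OF mm_ideal x])
  interpret L: ideal L R unfolding L_def by (rule add_ideals[OF assms(1) x])
  interpret J: ideal J R unfolding J_def by (rule add_ideals[OF assms(1) mx])
  have "I \<subseteq> J" unfolding J_def by (rule ideal_subset_set_add(1)[OF assms(1) mx])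
  have "x \<in> L"
    unfolding L_def using ideal_subset_set_add(2)[OF assms(1) x] cgenideal_self[OF assms(2)] by auto
  let ?C = "{K. ideal K R \<and> J \<subseteq> K \<and> K \<inter> L \<subseteq> J}"
  obtain K where K: "K \<in> ?C" and max: "\<And>K'. K' \<in> ?C \<Longrightarrow> K \<subseteq> K' \<Longrightarrow> K' = K"
    by (rule maximal_ideal_exists[of ?C]) (use J.is_ideal in auto)
  interpret K: ideal K R using K by simp
  have "\<exists>j::nat. y [^] j \<in> K" if y: "y \<in> \<mm>" for y
  proof -
    have yc: "y \<in> carrier R" using y by simp
    let ?A = "\<lambda>j::nat. {r \<in> carrier R. y [^] j \<otimes> r \<in> K}"
    have A: "ideal (?A j) R" for j
    proof (rule idealI, rule ring_axioms)
      show "subgroup (?A j) (add_monoid R)"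
        by unfold_locales (use yc in \<open>auto simp: r_distr r_minus simp flip: a_inv_def\<close>)
      show "c \<otimes> r \<in> ?A j" if "r \<in> ?A j" "c \<in> carrier R" for r c
        using that yc K.I_l_closed[of "y [^] j \<otimes> r" c] by (simp add: m_lcomm)
      then show "r \<otimes> c \<in> ?A j" if "r \<in> ?A j" "c \<in> carrier R" for r c
        using that by (metis (no_types, lifting) m_comm mem_Collect_eq)
    qed
    have "I \<in> range ?A \<Longrightarrow> ideal I R" for I using A by (elim imageE) (simp only:)
    \<comment> \<open>A maximal member of the family of colon ideals stands for stationarity: since
      \<open>?A j \<subseteq> ?A (Suc j)\<close>, the next member equals it.\<close>
    then obtain M where M: "M \<in> range ?A" "\<And>I. I \<in> range ?A \<Longrightarrow> M \<subseteq> I \<Longrightarrow> I = M"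
      by (rule_tac maximal_ideal_exists[of "range ?A"]) (simp_all only: empty_not_UNIV image_is_empty UNIV_not_empty not_False_eq_True)
    from M(1) obtain j where Mj: "M = ?A j" by (rule imageE)
    have j: "?A i = ?A j" if "?A j \<subseteq> ?A i" for i
      using M(2)[OF rangeI] that unfolding Mj .
    have "?A j \<subseteq> ?A (Suc j)"
    proof
      fix r assume r: "r \<in> ?A j"
      then have "y \<otimes> (y [^] j \<otimes> r) \<in> K" using K.I_l_closed yc by simp
      with r yc show "r \<in> ?A (Suc j)" by (simp add: m_ac)
    qed
    then have stable: "?A (Suc j) = ?A j" by (rule j)
    let ?K' = "K <+>\<^bsub>R\<^esub> PIdl (y [^] j)"
    have yj: "y [^] j \<in> carrier R" using yc by simp
    have K': "ideal ?K' R" by (intro add_ideals K.is_ideal cgenideal_ideal yj)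
    note KK' = ideal_subset_set_add[OF K.is_ideal cgenideal_ideal[OF yj]]
    have "?K' \<inter> L \<subseteq> J"
    proof
      fix z assume z: "z \<in> ?K' \<inter> L"
      then obtain k r where k: "k \<in> K" "r \<in> carrier R" "z = k \<oplus> r \<otimes> y [^] j"
        unfolding set_add_def' cgenideal_def by blast
      \<comment> \<open>Here \<open>\<mm> L \<subseteq> J\<close> enters, which is why
        \<open>J\<close> was built with \<open>\<mm> \<cdot> (PIdl x)\<close>. It puts
        \<open>y^(j+1) r\<close> into \<open>K\<close>, and stationarity gives
        \<open>y^j r \<in> K\<close>.\<close>
      have "y \<otimes> z \<in> J"
      proof -
        from z obtain i c where i: "i \<in> I" "c \<in> PIdl x" "z = i \<oplus> c"
          unfolding L_def set_add_def' by blast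
        have "c \<in> carrier R" using i(2) assms(2) by (auto simp: cgenideal_def)
        with i yc have "y \<otimes> z = y \<otimes> i \<oplus> y \<otimes> c" by (simp add: r_distr)
        moreover have "y \<otimes> i \<in> I" using i(1) yc by (rule I.I_l_closed)
        moreover have "y \<otimes> c \<in> \<mm> \<cdot> (PIdl x)" using y i(2) by (rule ideal_prod.prod)
        ultimately show ?thesis unfolding J_def by (simp add: set_add_memI)
      qed
      then have yz: "y \<otimes> z \<in> K" using K by auto
      have "y \<otimes> z = y \<otimes> k \<oplus> y [^] Suc j \<otimes> r"
        using k yc by (simp add: r_distr m_ac)
      then have "y [^] Suc j \<otimes> r = y \<otimes> z \<ominus> y \<otimes> k"
        using k yc by (simp add: minus_eq a_ac r_neg2 del: nat_pow_Suc)
      also have "\<dots> \<in> K" using yz k yc by (simp add: minus_eq K.I_l_closed)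
      finally have "r \<in> ?A (Suc j)" using k by simp
      then have "r \<in> ?A j" by (simp only: stable)
      then have "z \<in> K" using k yj by (simp add: m_comm)
      with z K show "z \<in> J" by auto
    qed
    moreover have "J \<subseteq> ?K'" using K KK'(1) by auto
    ultimately have "?K' = K" using max[of ?K'] K' KK'(1) by simp
    moreover have "y [^] j \<in> ?K'" using KK'(2) cgenideal_self[OF yj] by auto
    ultimately show ?thesis by auto
  qed
  from power_mm_subset[OF K.is_ideal this] obtain n where n: "ideal_power R \<mm> n \<subseteq> K" by blast
  obtain i e where "i \<in> I" "e \<in> ideal_power R \<mm> n" "x = i \<oplus> e"
    using assms(3)[of n] unfolding set_add_def' by blast
  then have "x \<in> K" using n K \<open>I \<subseteq> J\<close> by auto
  then have "x \<in> J" using K \<open>x \<in> L\<close> by auto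
  then obtain i c where i: "i \<in> I" "c \<in> \<mm> \<cdot> (PIdl x)" "x = i \<oplus> c"
    unfolding J_def set_add_def' by blast
  \<comment> \<open>From \<open>x = i + e x\<close> with \<open>1 - e\<close> a unit,
    \<open>x\<close> is a multiple of \<open>i\<close>.\<close>
  obtain e where e: "e \<in> \<mm>" "c = e \<otimes> x"
    using mem_ideal_prod_PIdl[OF mm_ideal assms(2) i(2)] .
  have u: "\<one> \<ominus> e \<in> Units R" by (rule one_minus_unit[OF e(1)])
  have ec: "e \<in> carrier R" using e by simp
  have "(\<one> \<ominus> e) \<otimes> x = x \<ominus> e \<otimes> x"
    using ec assms(2) by algebra
  also have "\<dots> = (i \<oplus> e \<otimes> x) \<ominus> e \<otimes> x"
    using i(3) e(2) by simp
  also have "\<dots> = i"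
    using i(1) ec assms(2) by (simp add: minus_eq a_assoc r_neg)
  finally have "inv (\<one> \<ominus> e) \<otimes> i = x"
    using u assms(2) i(1) by (metis I.Icarr Units_inv_closed Units_closed Units_l_inv l_one m_assoc)
  then show ?thesis using I.I_l_closed[OF i(1)] u by (metis Units_inv_closed)
qed

text \<open>Reinserting the inclusion into itself gives \<open>I \<subseteq> aR + \<mm>^n\<close>
  for every \<open>n\<close>, and Krull's intersection theorem for the ideal \<open>aR\<close>
  concludes.\<close>

lemma nakayama_principal:
  assumes "ideal I R" "a \<in> carrier R" "I \<subseteq> PIdl a <+>\<^bsub>R\<^esub> (\<mm> \<cdot> I)"
  shows "I \<subseteq> PIdl a"
proof
  interpret I: ideal I R by fact
  have a: "ideal (PIdl a) R" by (rule cgenideal_ideal[OF assms(2)])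
  interpret a: ideal "PIdl a" R by (rule a)
  have "I \<subseteq> PIdl a <+>\<^bsub>R\<^esub> ideal_power R \<mm> n" for n
  proof (induction n)
    case 0
    show ?case using ideal_subset_set_add(2)[OF a oneideal] I.a_subset by simp
  next
    case (Suc n)
    let ?J = "PIdl a <+>\<^bsub>R\<^esub> ideal_power R \<mm> (Suc n)"
    interpret P: ideal "ideal_power R \<mm> (Suc n)" R by (rule ideal_power_ideal[OF mm_ideal])
    interpret J: ideal ?J R by (intro add_ideals a P.is_ideal)
    note aJ = ideal_subset_set_add(1)[OF a P.is_ideal] and PJ = ideal_subset_set_add(2)[OF a P.is_ideal]
    have "x \<in> ?J" if "x \<in> \<mm> \<cdot> I" for x
      using that
    proof (induction rule: ideal_prod.induct)
      case (prod e i)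
      with Suc.IH obtain b p where bp: "b \<in> PIdl a" "p \<in> ideal_power R \<mm> n" "i = b \<oplus> p"
        unfolding set_add_def' by blast
      then have carr: "b \<in> carrier R" "p \<in> carrier R" "e \<in> carrier R"
        using ideal.Icarr[OF ideal_power_ideal[OF mm_ideal]] prod by auto
      have "e \<otimes> b \<in> ?J" using aJ a.I_l_closed[OF bp(1) carr(3)] by auto
      moreover have "p \<otimes> e \<in> ?J" using PJ ideal_prod.prod[OF bp(2) prod(1), of R] by auto
      ultimately have "e \<otimes> b \<oplus> p \<otimes> e \<in> ?J" by (rule J.a_closed)
      then show ?case using carr bp(3) by (simp add: r_distr m_comm[of e p])
    qed (rule J.a_closed)
    then show ?case using assms(3) aJ J.a_closed unfolding set_add_def'[of R "PIdl a" "\<mm> \<cdot> I"] by blast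
  qed
  then show "x \<in> PIdl a" if "x \<in> I" for x
    using that krull_intersection[OF a, of x] by auto
qed

end

section \<open>The completion\<close>

primrec (in ring) partial_sum :: "(nat \<Rightarrow> 'a) \<Rightarrow> nat \<Rightarrow> 'a"
  where
    "partial_sum d 0 = d 0"
  | "partial_sum d (Suc n) = partial_sum d n \<oplus> d (Suc n)"

lemma (in ring) partial_sum_closed: "(\<And>n. d n \<in> carrier R) \<Longrightarrow> partial_sum d n \<in> carrier R"
  by (induction n) auto

section \<open>Elements of the completion as limits of coherent sequences\<close>

context noetherian_local
begin

abbreviation P :: "nat \<Rightarrow> 'a set"
  where "P n \<equiv> ideal_power R \<mm> n"

abbreviation C :: "(nat \<Rightarrow> 'a set) ring"
  where "C \<equiv> completion R \<mm>"

abbreviation \<phi> :: "'a \<Rightarrow> nat \<Rightarrow> 'a set"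
  where "\<phi> \<equiv> completion_map R \<mm>"

lemma P_ideal: "ideal (P n) R"
  by (rule ideal_power_ideal[OF mm_ideal])

lemma P_abelian_subgroup: "abelian_subgroup (P n) R"
  by (rule abelian_subgroupI3[OF ideal.axioms(1)[OF P_ideal] abelian_group_axioms])

lemma P_mono: "m \<le> n \<Longrightarrow> P n \<subseteq> P m"
  by (rule ideal_power_decreasing[OF mm_ideal])

lemma P_carrier: "a \<in> P n \<Longrightarrow> a \<in> carrier R"
  by (rule ideal.Icarr[OF P_ideal])

lemma P_1: "P (Suc 0) = \<mm>"
  using ideal_prod_one[OF mm_ideal] ideal_prod_commute[OF mm_ideal oneideal] by simp

text \<open>The value \<open>e n\<close> is a representative in \<open>R\<close> of the component in
  \<open>R/\<mm>^n\<close>. Such sequences allow calculations in \<open>R\<close> in place of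
  cosets; \<open>e 0\<close> is arbitrary, because \<open>\<mm>^0\<close> is the whole ring.\<close>

definition coherent :: "(nat \<Rightarrow> 'a) \<Rightarrow> bool"
  where "coherent e \<longleftrightarrow> (\<forall>n. e n \<in> carrier R \<and> e (Suc n) \<ominus> e n \<in> P n)"

definition limit :: "(nat \<Rightarrow> 'a) \<Rightarrow> nat \<Rightarrow> 'a set"
  where "limit e = (\<lambda>n. P n +> e n)"

lemma coherentD [simp]: "coherent e \<Longrightarrow> e n \<in> carrier R"
  by (simp add: coherent_def)

lemma coset_eq_iff:
  assumes "a \<in> carrier R" "b \<in> carrier R"
  shows "P n +> a = P n +> b \<longleftrightarrow> a \<ominus> b \<in> P n"
  using ring.quotient_eq_iff_same_a_r_cos[OF ring_axioms P_ideal assms] by simp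

lemma limit_eq_iff:
  assumes "\<And>n. e n \<in> carrier R" "\<And>n. f n \<in> carrier R"
  shows "limit e = limit f \<longleftrightarrow> (\<forall>n. e n \<ominus> f n \<in> P n)"
  using assms by (simp add: limit_def fun_eq_iff coset_eq_iff)

lemma mem_coset_iff:
  assumes "a \<in> carrier R" "b \<in> carrier R"
  shows "a \<in> P n +> b \<longleftrightarrow> a \<ominus> b \<in> P n"
  using abelian_subgroup.a_rcos_module_minus[OF P_abelian_subgroup ring_axioms assms(2,1)] .

text \<open>The coherence condition of \<open>completion\<close> is an inclusion of cosets; for
  representatives it becomes a congruence.\<close>

lemma coset_subset_iff:
  assumes "a \<in> carrier R" "b \<in> carrier R"
  shows "P (Suc n) +> a \<subseteq> P n +> b \<longleftrightarrow> a \<ominus> b \<in> P n"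
proof
  have "a \<in> P (Suc n) +> a"
    using abelian_subgroup.a_rcos_self[OF P_abelian_subgroup assms(1)] .
  then show "a \<ominus> b \<in> P n" if "P (Suc n) +> a \<subseteq> P n +> b"
    using that assms by (auto simp: mem_coset_iff)
next
  assume "a \<ominus> b \<in> P n"
  then have "P n +> a = P n +> b" by (simp add: coset_eq_iff assms)
  moreover have "P (Suc n) +> a \<subseteq> P n +> a"
    using P_mono[of n "Suc n"] by (auto simp: a_r_coset_def')
  ultimately show "P (Suc n) +> a \<subseteq> P n +> b" by simp
qed

lemma limit_in_carrier:
  assumes "coherent e"
  shows "limit e \<in> carrier C"
proof -
  have "P (Suc n) +> e (Suc n) \<subseteq> P n +> e n" for n
    using assms by (simp add: coset_subset_iff coherent_def del: Group.nat_pow_Suc)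
  moreover have "P n +> e n \<in> a_rcosets P n" for n
    using assms P_carrier by (intro a_rcosetsI) auto
  ultimately show ?thesis
    by (simp add: completion_def limit_def FactRing_def del: Group.nat_pow_Suc)
qed

lemma carrier_limit:
  assumes "x \<in> carrier C"
  obtains e where "coherent e" "x = limit e"
proof -
  have "\<exists>a. a \<in> carrier R \<and> x n = P n +> a" for n
    using assms by (simp add: completion_def FactRing_def A_RCOSETS_def' Bex_def)
  then obtain e where e: "e n \<in> carrier R" "x n = P n +> e n" for n by metis
  moreover have "x (Suc n) \<subseteq> x n" for n using assms by (simp add: completion_def)
  ultimately have "coherent e" by (simp add: coherent_def coset_subset_iff del: Group.nat_pow_Suc)
  moreover have "x = limit e" using e by (auto simp: limit_def)
  ultimately show thesis using that by blast
qed

lemma coherent_const: "r \<in> carrier R \<Longrightarrow> coherent (\<lambda>n. r)"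
  using additive_subgroup.zero_closed[OF ideal.axioms(1)[OF P_ideal]]
  by (simp add: coherent_def minus_eq r_neg)

lemma coherent_add:
  assumes "coherent e" "coherent f"
  shows "coherent (\<lambda>n. e n \<oplus> f n)"
proof -
  interpret P: ideal "P n" R for n by (rule P_ideal)
  have "e (Suc n) \<oplus> f (Suc n) \<ominus> (e n \<oplus> f n) = (e (Suc n) \<ominus> e n) \<oplus> (f (Suc n) \<ominus> f n)" for n
    using assms[THEN coherentD] by algebra
  with assms show ?thesis by (simp add: coherent_def del: Group.nat_pow_Suc)
qed

lemma coherent_mult:
  assumes "coherent e" "coherent f"
  shows "coherent (\<lambda>n. e n \<otimes> f n)"
proof -
  interpret P: ideal "P n" R for n by (rule P_ideal)
  have "e (Suc n) \<otimes> f (Suc n) \<ominus> e n \<otimes> f n =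
      e (Suc n) \<otimes> (f (Suc n) \<ominus> f n) \<oplus> (e (Suc n) \<ominus> e n) \<otimes> f n" for n
    using assms[THEN coherentD] by algebra
  with assms show ?thesis by (simp add: coherent_def P.I_l_closed P.I_r_closed)
qed

lemma coherent_minus:
  assumes "coherent e"
  shows "coherent (\<lambda>n. \<ominus> e n)"
  using coherent_mult[OF coherent_const[of "\<ominus> \<one>"] assms] assms by (simp add: l_minus)

lemma completion_add:
  "coherent e \<Longrightarrow> coherent f \<Longrightarrow> limit e \<oplus>\<^bsub>C\<^esub> limit f = limit (\<lambda>n. e n \<oplus> f n)"
  by (simp add: completion_def limit_def ring_hom_add[OF ideal.rcos_ring_hom[OF P_ideal]])

lemma completion_mult:
  "coherent e \<Longrightarrow> coherent f \<Longrightarrow> limit e \<otimes>\<^bsub>C\<^esub> limit f = limit (\<lambda>n. e n \<otimes> f n)"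
  by (simp add: completion_def limit_def ring_hom_mult[OF ideal.rcos_ring_hom[OF P_ideal]])

lemma completion_map_limit: "\<phi> r = limit (\<lambda>n. r)"
  by (simp add: completion_map_def limit_def)

lemma completion_one: "\<one>\<^bsub>C\<^esub> = limit (\<lambda>n. \<one>)"
  by (simp add: completion_def limit_def FactRing_def)

lemma completion_zero: "\<zero>\<^bsub>C\<^esub> = limit (\<lambda>n. \<zero>)"
  by (simp add: completion_def limit_def FactRing_def a_coset_add_zero subsetI P_carrier)

lemma completion_cring: "cring C"
proof (rule cringI)
  note limits = completion_add completion_mult completion_one completion_zero
    coherent_add coherent_mult coherent_const coherent_minus limit_in_carrier
  show "abelian_group C"
  proof (rule abelian_groupI)
    show "x \<oplus>\<^bsub>C\<^esub> y \<in> carrier C" if "x \<in> carrier C" "y \<in> carrier C" for x y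
      using that by (elim carrier_limit) (simp add: limits)
    show "\<zero>\<^bsub>C\<^esub> \<in> carrier C" by (simp add: limits)
    show "x \<oplus>\<^bsub>C\<^esub> y \<oplus>\<^bsub>C\<^esub> z = x \<oplus>\<^bsub>C\<^esub> (y \<oplus>\<^bsub>C\<^esub> z)"
      if "x \<in> carrier C" "y \<in> carrier C" "z \<in> carrier C" for x y z
      using that by (elim carrier_limit) (simp add: limits a_assoc)
    show "x \<oplus>\<^bsub>C\<^esub> y = y \<oplus>\<^bsub>C\<^esub> x" if "x \<in> carrier C" "y \<in> carrier C" for x y
      using that by (elim carrier_limit) (simp add: limits a_comm)
    show "\<zero>\<^bsub>C\<^esub> \<oplus>\<^bsub>C\<^esub> x = x" if "x \<in> carrier C" for x
      using that by (elim carrier_limit) (simp add: limits)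
    show "\<exists>y \<in> carrier C. y \<oplus>\<^bsub>C\<^esub> x = \<zero>\<^bsub>C\<^esub>" if "x \<in> carrier C" for x
    proof -
      from that obtain e where "coherent e" "x = limit e" by (rule carrier_limit)
      then show ?thesis
        by (intro bexI[of _ "limit (\<lambda>n. \<ominus> e n)"]) (simp_all add: limits l_neg)
    qed
  qed
  show "Group.comm_monoid C"
  proof (rule comm_monoidI)
    show "x \<otimes>\<^bsub>C\<^esub> y \<in> carrier C" if "x \<in> carrier C" "y \<in> carrier C" for x y
      using that by (elim carrier_limit) (simp add: limits)
    show "\<one>\<^bsub>C\<^esub> \<in> carrier C" by (simp add: limits)
    show "x \<otimes>\<^bsub>C\<^esub> y \<otimes>\<^bsub>C\<^esub> z = x \<otimes>\<^bsub>C\<^esub> (y \<otimes>\<^bsub>C\<^esub> z)"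
      if "x \<in> carrier C" "y \<in> carrier C" "z \<in> carrier C" for x y z
      using that by (elim carrier_limit) (simp add: limits m_assoc)
    show "\<one>\<^bsub>C\<^esub> \<otimes>\<^bsub>C\<^esub> x = x" if "x \<in> carrier C" for x
      using that by (elim carrier_limit) (simp add: limits)
    show "x \<otimes>\<^bsub>C\<^esub> y = y \<otimes>\<^bsub>C\<^esub> x" if "x \<in> carrier C" "y \<in> carrier C" for x y
      using that by (elim carrier_limit) (simp add: limits m_comm)
  qed
  show "(x \<oplus>\<^bsub>C\<^esub> y) \<otimes>\<^bsub>C\<^esub> z = x \<otimes>\<^bsub>C\<^esub> z \<oplus>\<^bsub>C\<^esub> y \<otimes>\<^bsub>C\<^esub> z"
    if "x \<in> carrier C" "y \<in> carrier C" "z \<in> carrier C" for x y z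
    using that by (elim carrier_limit) (simp add: limits l_distr)
qed

lemma completion_map_hom: "\<phi> \<in> ring_hom R C"
  by (rule ring_hom_memI)
    (simp_all add: completion_map_limit completion_add completion_mult completion_one
      coherent_const limit_in_carrier)

sublocale completion: ring_hom_cring R C \<phi>
  by (intro ring_hom_cring.intro cring_axioms completion_cring ring_hom_cring_axioms.intro
      completion_map_hom)

text \<open>The extension of \<open>I\<close> reduces modulo \<open>\<mm>^n\<close> into the image
  of \<open>I\<close>: a generator \<open>\<phi> i s\<close> with \<open>s = limit e\<close> has the
  representative \<open>i \<otimes> e n\<close> there.\<close>

lemma ext_coset_subset:
  assumes "ideal I R" "x \<in> completion.ext I"
  shows "x n \<subseteq> I <+>\<^bsub>R\<^esub> P n"
proof -
  interpret I: ideal I R by fact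
  interpret P: ideal "P n" R by (rule P_ideal)
  interpret J: ideal "I <+>\<^bsub>R\<^esub> P n" R by (rule add_ideals[OF assms(1) P_ideal])
  note J = ideal_subset_set_add[OF assms(1) P_ideal, of n]
  have coset: "P n +> a \<subseteq> I <+>\<^bsub>R\<^esub> P n" if "a \<in> I <+>\<^bsub>R\<^esub> P n" for a
    using that J(2) by (auto simp: a_r_coset_def')
  have "\<exists>e. coherent e \<and> x = limit e \<and> e n \<in> I <+>\<^bsub>R\<^esub> P n"
    using assms(2)
  proof (induction rule: completion.ext_induct)
    case (mult i s)
    obtain e where e: "coherent e" "s = limit e" using mult(2) by (rule carrier_limit)
    have i: "i \<in> carrier R" using mult(1) by simp
    have "i \<otimes> e n \<in> I <+>\<^bsub>R\<^esub> P n" using J(1) I.I_r_closed[OF mult(1) coherentD[OF e(1)]] by blast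
    with e i show ?case
      by (intro exI[of _ "\<lambda>n. i \<otimes> e n"])
        (simp add: completion_map_limit completion_mult coherent_const coherent_mult)
  next
    case (add s t)
    then obtain e f where "coherent e" "coherent f" "s = limit e" "t = limit f"
      "e n \<in> I <+>\<^bsub>R\<^esub> P n" "f n \<in> I <+>\<^bsub>R\<^esub> P n" by blast
    then show ?case
      by (intro exI[of _ "\<lambda>n. e n \<oplus> f n"]) (simp add: completion_add coherent_add)
  qed
  then show ?thesis using coset by (auto simp: limit_def)
qed

text \<open>For every \<open>n\<close> the element \<open>r\<close> lies in the \<open>n\<close>-th
  coset of \<open>\<phi> r\<close>, hence in \<open>I + \<mm>^n\<close>, and Krull's intersection
  theorem applies.\<close>

lemma completion_contraction:
  assumes "ideal I R" "r \<in> carrier R" "\<phi> r \<in> completion.ext I"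
  shows "r \<in> I"
proof (rule krull_intersection[OF assms(1,2)])
  fix n
  have "r \<in> \<phi> r n"
    using abelian_subgroup.a_rcos_self[OF P_abelian_subgroup assms(2)] by (simp add: completion_map_def)
  with ext_coset_subset[OF assms(1,3)] show "r \<in> I <+>\<^bsub>R\<^esub> P n" by blast
qed

text \<open>The term \<open>d (Suc n)\<close> is the step from level \<open>n\<close> to level
  \<open>n + 1\<close>, so it has to lie in \<open>P n\<close>; truncated subtraction leaves
  \<open>d 0\<close> and \<open>d 1\<close> free in \<open>R\<close>.\<close>

lemma partial_sum_coherent:
  assumes "\<And>n. d n \<in> P (n - 1)"
  shows "coherent (partial_sum d)"
proof -
  have d: "d n \<in> carrier R" for n using assms P_carrier by blast
  then have "partial_sum d (Suc n) \<ominus> partial_sum d n = d (Suc n)" for n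
    using partial_sum_closed[of d n] d[of "Suc n"] by (simp, algebra)
  moreover have "d (Suc n) \<in> P n" for n using assms[of "Suc n"] by simp
  ultimately show ?thesis using d by (simp add: coherent_def partial_sum_closed)
qed

text \<open>The terms \<open>d 0\<close> and \<open>d 1\<close> both lie in \<open>P 0 \<cdot> Idl A\<close>, since \<open>0 - 1 = 0\<close>.\<close>
lemma limit_partial_sum_in_ext:
  assumes "finite A" "A \<subseteq> carrier R" "\<And>n. d n \<in> P (n - 1) \<cdot> (Idl A)"
  shows "limit (partial_sum d) \<in> completion.ext (Idl A)"
  using assms
proof (induction A arbitrary: d)
  case empty
  have "Idl {} \<subseteq> {\<zero>}" by (rule genideal_minimal[OF zeroideal]) simp
  moreover have "d n \<in> Idl {}" for n
    using empty(2)[of n] ideal_prod_inter[OF P_ideal genideal_ideal[of "{}"]] by blast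
  ultimately have d: "d n = \<zero>" for n by blast
  have "partial_sum d n = \<zero>" for n by (induction n) (simp_all add: d)
  then have "limit (partial_sum d) = \<zero>\<^bsub>C\<^esub>" by (simp add: completion_zero limit_def)
  with completion.ext_ideal[OF genideal_ideal[of "{}"]] show ?case
    by (simp add: additive_subgroup.zero_closed ideal.axioms(1))
next
  case (insert a A)
  have carr: "a \<in> carrier R" "A \<subseteq> carrier R" using insert.prems by auto
  have a: "ideal (PIdl a) R" by (rule cgenideal_ideal[OF carr(1)])
  have A: "ideal (Idl A) R" by (rule genideal_ideal[OF carr(2)])
  have "Idl (insert a A) \<subseteq> PIdl a <+>\<^bsub>R\<^esub> Idl A"
    using ideal_subset_set_add[OF a A] cgenideal_self[OF carr(1)] genideal_self[OF carr(2)]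
    by (intro genideal_minimal add_ideals a A) auto
  \<comment> \<open>Each term is split as \<open>b n a + c n\<close>. The coefficients
    \<open>b n\<close> lie in \<open>P (n - 1)\<close>, so their partial sums converge as well, and
    the series of the \<open>d n\<close> becomes \<open>\<phi> a\<close> times one element of the
    completion plus a series over the smaller generating set \<open>A\<close>.\<close>
  have "\<exists>b c. b \<in> P (n - 1) \<and> c \<in> P (n - 1) \<cdot> (Idl A) \<and> d n = b \<otimes> a \<oplus> c" for n
  proof -
    have "d n \<in> P (n - 1) \<cdot> (PIdl a <+>\<^bsub>R\<^esub> Idl A)"
      using insert.prems(2)[of n] ideal_prod_mono[OF order_refl \<open>Idl (insert a A) \<subseteq> _\<close>] by blast
    then have "d n \<in> (P (n - 1) \<cdot> (PIdl a)) <+>\<^bsub>R\<^esub> (P (n - 1) \<cdot> (Idl A))"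
      by (simp add: ideal_prod_distr(1)[OF P_ideal a A])
    then obtain b' c where "b' \<in> P (n - 1) \<cdot> (PIdl a)" "c \<in> P (n - 1) \<cdot> (Idl A)" "d n = b' \<oplus> c"
      unfolding set_add_def' by blast
    then show ?thesis using mem_ideal_prod_PIdl[OF P_ideal carr(1)] by metis
  qed
  then obtain b c where bc: "b n \<in> P (n - 1)" "c n \<in> P (n - 1) \<cdot> (Idl A)" "d n = b n \<otimes> a \<oplus> c n" for n
    by metis
  have c: "c n \<in> P (n - 1)" for n
    using bc(2)[of n] ideal_prod_inter[OF P_ideal A] by blast
  have coh: "coherent (partial_sum b)" "coherent (partial_sum c)"
    by (intro partial_sum_coherent bc c)+
  have "partial_sum d n = a \<otimes> partial_sum b n \<oplus> partial_sum c n" for n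
  proof (induction n)
    case 0
    show ?case using bc(1)[of 0] c[of 0, THEN P_carrier] carr by (simp add: bc(3) m_comm P_carrier)
  next
    case (Suc n)
    have "partial_sum b n \<in> carrier R" "partial_sum c n \<in> carrier R" "b (Suc n) \<in> carrier R" "c (Suc n) \<in> carrier R"
      using coh bc(1)[THEN P_carrier] c[THEN P_carrier] by auto
    with carr Suc show ?case by (simp add: bc(3), algebra)
  qed
  then have sum: "partial_sum d = (\<lambda>n. a \<otimes> partial_sum b n \<oplus> partial_sum c n)" by (rule HOL.ext)
  have "limit (partial_sum d) = \<phi> a \<otimes>\<^bsub>C\<^esub> limit (partial_sum b) \<oplus>\<^bsub>C\<^esub> limit (partial_sum c)"
    unfolding sum using coh carr
    by (simp add: completion_map_limit completion_mult completion_add coherent_const coherent_mult)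
  moreover have "\<phi> a \<otimes>\<^bsub>C\<^esub> limit (partial_sum b) \<in> completion.ext (Idl (insert a A))"
    using coh insert.prems genideal_self[of "insert a A"] by (intro completion.ext_mult limit_in_carrier) auto
  moreover have "limit (partial_sum c) \<in> completion.ext (Idl (insert a A))"
  proof -
    have "Idl A \<subseteq> Idl (insert a A)"
      using insert.prems genideal_self[of "insert a A"] by (intro genideal_minimal genideal_ideal) auto
    with insert.IH[OF carr(2) bc(2)] completion.ext_mono show ?thesis by blast
  qed
  ultimately show ?case by (simp add: completion.ext_add)
qed

text \<open>The telescoping series \<open>e 1 + (e 2 - e 1) + ...\<close> has its
  \<open>n\<close>-th term in \<open>P (n - 1) \<cdot> \<mm>\<close>, and \<open>\<mm>\<close> is
  finitely generated. Its partial sums are \<open>e\<close> shifted by one place, which has the same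
  limit.\<close>

lemma limit_in_ext_mm:
  assumes "coherent e" "e 1 \<in> \<mm>"
  shows "limit e \<in> completion.ext \<mm>"
proof -
  obtain A where A: "A \<subseteq> carrier R" "finite A" "\<mm> = Idl A"
    using noetherian_ring.finetely_gen[OF noetherian mm_ideal] by blast
  define d where "d n = (case n of 0 \<Rightarrow> e 1 | Suc k \<Rightarrow> e (Suc n) \<ominus> e n)" for n
  have carr: "e n \<in> carrier R" for n using assms by simp
  have sum: "partial_sum d n = e (Suc n)" for n
  proof (induction n)
    case (Suc n)
    then show ?case
      using carr[of "Suc n"] carr[of "Suc (Suc n)"] by (simp add: d_def, algebra)
  qed (simp add: d_def)
  have "d n \<in> P (n - 1) \<cdot> \<mm>" for n
  proof (cases n)
    case 0
    with assms(2) P_1 show ?thesis by (simp add: d_def)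
  next
    case (Suc k)
    have "e (Suc (Suc k)) \<ominus> e (Suc k) \<in> P (Suc k)" using assms(1) unfolding coherent_def by blast
    with Suc show ?thesis by (simp add: d_def)
  qed
  with limit_partial_sum_in_ext[OF A(2,1), of d] have "limit (partial_sum d) \<in> completion.ext \<mm>"
    by (simp add: A(3))
  moreover have "limit (partial_sum d) = limit e"
    using assms(1) carr by (subst limit_eq_iff) (auto simp: sum coherent_def)
  ultimately show ?thesis by simp
qed

text \<open>All \<open>e (Suc n)\<close> are congruent to \<open>e 1\<close> modulo
  \<open>\<mm>\<close>, hence units of \<open>R\<close>, and their inverses form a coherent
  sequence.\<close>

lemma unit_outside_ext_mm:
  assumes "x \<in> carrier C" "x \<notin> completion.ext \<mm>"
  shows "x \<in> Units C"
proof -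
  obtain e where e: "coherent e" "x = limit e" using assms(1) by (rule carrier_limit)
  then have e1: "e 1 \<notin> \<mm>" using limit_in_ext_mm assms(2) by blast
  have carr: "e n \<in> carrier R" for n using e by simp
  have mm: "e (Suc n) \<notin> \<mm>" for n
  proof (induction n)
    case (Suc n)
    show ?case
    proof
      assume "e (Suc (Suc n)) \<in> \<mm>"
      moreover have "e (Suc (Suc n)) \<ominus> e (Suc n) \<in> \<mm>"
        using e(1) P_mono[of "Suc 0" "Suc n"] unfolding coherent_def P_1 by blast
      ultimately have "e (Suc (Suc n)) \<ominus> (e (Suc (Suc n)) \<ominus> e (Suc n)) \<in> \<mm>"
        by (simp add: minus_eq)
      moreover have "e (Suc (Suc n)) \<ominus> (e (Suc (Suc n)) \<ominus> e (Suc n)) = e (Suc n)"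
        using carr[of "Suc n"] carr[of "Suc (Suc n)"] by algebra
      ultimately show False using Suc by simp
    qed
  qed (use e1 in simp)
  have u: "e (Suc n) \<in> Units R" for n using unit_outside_mm[OF carr mm] .
  \<comment> \<open>The shift by one avoids \<open>e 0\<close>, which may be a non-unit.\<close>
  define f where "f n = inv (e (Suc n))" for n
  have f: "f n \<in> carrier R" "f n \<otimes> e (Suc n) = \<one>" for n using u by (simp_all add: f_def)
  have "f (Suc n) \<ominus> f n \<in> P n" for n
  proof -
    interpret P: ideal "P n" R by (rule P_ideal)
    have "e (Suc (Suc n)) \<ominus> e (Suc n) \<in> P (Suc n)" using e(1) unfolding coherent_def by blast
    then have "e (Suc (Suc n)) \<ominus> e (Suc n) \<in> P n" using P_mono[of n "Suc n"] by auto
    \<comment> \<open>This is \<open>1/v - 1/u = - (1/u) (1/v) (v - u)\<close> with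
      \<open>u = e (n+1)\<close> and \<open>v = e (n+2)\<close>.\<close>
    then have "\<ominus> (f n \<otimes> f (Suc n)) \<otimes> (e (Suc (Suc n)) \<ominus> e (Suc n)) \<in> P n"
      using f by (intro P.I_l_closed) auto
    also have "\<ominus> (f n \<otimes> f (Suc n)) \<otimes> (e (Suc (Suc n)) \<ominus> e (Suc n)) =
        f (Suc n) \<otimes> (f n \<otimes> e (Suc n)) \<ominus> f n \<otimes> (f (Suc n) \<otimes> e (Suc (Suc n)))"
      using f(1)[of n] f(1)[of "Suc n"] carr[of "Suc n"] carr[of "Suc (Suc n)"] by algebra
    finally show ?thesis using f by simp
  qed
  then have fc: "coherent f" using f by (simp add: coherent_def)
  have "limit (\<lambda>n. f n \<otimes> e n) = limit (\<lambda>n. \<one>)"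
  proof (subst limit_eq_iff)
    show "\<forall>n. f n \<otimes> e n \<ominus> \<one> \<in> P n"
    proof
      fix n
      interpret P: ideal "P n" R by (rule P_ideal)
      have "e (Suc n) \<ominus> e n \<in> P n" using e(1) by (simp add: coherent_def)
      then have "\<ominus> f n \<otimes> (e (Suc n) \<ominus> e n) \<in> P n" using f by (intro P.I_l_closed) auto
      also have "\<ominus> f n \<otimes> (e (Suc n) \<ominus> e n) = f n \<otimes> e n \<ominus> f n \<otimes> e (Suc n)"
        using f(1)[of n] carr[of n] carr[of "Suc n"] by algebra
      finally show "f n \<otimes> e n \<ominus> \<one> \<in> P n" using f by simp
    qed
  qed (use f carr in auto)
  then have "limit f \<otimes>\<^bsub>C\<^esub> x = \<one>\<^bsub>C\<^esub>"
    using e fc by (simp add: completion_mult completion_one)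
  moreover have "limit f \<in> carrier C" using fc by (rule limit_in_carrier)
  ultimately show ?thesis
    using assms(1) completion.S.m_comm unfolding Units_def by fastforce
qed

section \<open>Principal ideals of the completion\<close>

lemma one_minus_unit_completion:
  assumes "s \<in> completion.ext \<mm>"
  shows "\<one>\<^bsub>C\<^esub> \<ominus>\<^bsub>C\<^esub> s \<in> Units C"
proof (rule unit_outside_ext_mm)
  interpret M: ideal "completion.ext \<mm>" C by (rule completion.ext_ideal[OF mm_ideal])
  have s: "s \<in> carrier C" using assms by simp
  then show "\<one>\<^bsub>C\<^esub> \<ominus>\<^bsub>C\<^esub> s \<in> carrier C" by simp
  show "\<one>\<^bsub>C\<^esub> \<ominus>\<^bsub>C\<^esub> s \<notin> completion.ext \<mm>"
  proof
    assume "\<one>\<^bsub>C\<^esub> \<ominus>\<^bsub>C\<^esub> s \<in> completion.ext \<mm>"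
    then have "(\<one>\<^bsub>C\<^esub> \<ominus>\<^bsub>C\<^esub> s) \<oplus>\<^bsub>C\<^esub> s \<in> completion.ext \<mm>" using assms by simp
    moreover have "(\<one>\<^bsub>C\<^esub> \<ominus>\<^bsub>C\<^esub> s) \<oplus>\<^bsub>C\<^esub> s = \<phi> \<one>"
      using s by (simp add: completion.S.minus_eq completion.S.a_assoc completion.S.l_neg)
    ultimately show False
      using completion_contraction[OF mm_ideal one_closed] one_notin_mm by simp
  qed
qed

text \<open>Modulo \<open>completion.ext \<mm>\<close> every \<open>s\<close> in the completion
  equals the image of the representative \<open>e 1\<close> of its first component. So
  \<open>\<phi> i s\<close> is \<open>\<phi> (i \<otimes> e 1)\<close> plus \<open>\<phi> i\<close>
  times an element of \<open>completion.ext \<mm>\<close>.\<close>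

lemma ext_modulo_mm:
  assumes "ideal I R" "x \<in> completion.ext I"
  obtains a y where "a \<in> I" "y \<in> completion.ext (\<mm> \<cdot> I)" "x = \<phi> a \<oplus>\<^bsub>C\<^esub> y"
proof -
  interpret I: ideal I R by fact
  interpret E: ideal "completion.ext (\<mm> \<cdot> I)" C
    by (intro completion.ext_ideal ideal_prod_is_ideal mm_ideal assms(1))
  interpret M: ideal "completion.ext \<mm>" C by (rule completion.ext_ideal[OF mm_ideal])
  have hom_mult: "\<phi> i \<otimes>\<^bsub>C\<^esub> y \<in> completion.ext (\<mm> \<cdot> I)" if "i \<in> I" "y \<in> completion.ext \<mm>" for i y
    using that(2)
  proof (induction rule: completion.ext_induct)
    case (mult e s)
    have "i \<in> carrier R" "e \<in> carrier R" using that(1) mult by simp_all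
    then have "\<phi> i \<otimes>\<^bsub>C\<^esub> (\<phi> e \<otimes>\<^bsub>C\<^esub> s) = \<phi> (e \<otimes> i) \<otimes>\<^bsub>C\<^esub> s"
      using mult(2) by (simp add: completion.S.m_ac)
    with mult that(1) show ?case by (simp only:) (intro completion.ext_mult ideal_prod.prod)
  next
    case (add s t)
    have "i \<in> carrier R" using that(1) by simp
    with add show ?case by (simp add: completion.S.r_distr)
  qed
  from assms(2) have "\<exists>a \<in> I. \<exists>y \<in> completion.ext (\<mm> \<cdot> I). x = \<phi> a \<oplus>\<^bsub>C\<^esub> y"
  proof (induction rule: completion.ext_induct)
    case (mult i s)
    obtain e where e: "coherent e" "s = limit e" using mult(2) by (rule carrier_limit)
    define y where "y = s \<oplus>\<^bsub>C\<^esub> \<phi> (\<ominus> e 1)"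
    have carr: "i \<in> carrier R" "e 1 \<in> carrier R" using mult(1) e(1) by simp_all
    have "y = limit (\<lambda>n. e n \<oplus> \<ominus> e 1)"
      unfolding y_def e(2) completion_map_limit using e(1) carr by (simp add: completion_add coherent_const)
    moreover have "limit (\<lambda>n. e n \<oplus> \<ominus> e 1) \<in> completion.ext \<mm>"
      using e(1) carr by (intro limit_in_ext_mm coherent_add coherent_const) (simp_all add: r_neg)
    ultimately have y: "y \<in> completion.ext \<mm>" by simp
    have "s = \<phi> (e 1) \<oplus>\<^bsub>C\<^esub> y"
      using mult(2) carr by (simp add: y_def completion.S.a_lcomm completion.S.r_neg)
    then have "\<phi> i \<otimes>\<^bsub>C\<^esub> s = \<phi> (i \<otimes> e 1) \<oplus>\<^bsub>C\<^esub> \<phi> i \<otimes>\<^bsub>C\<^esub> y"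
      using y carr by (simp add: completion.S.r_distr)
    with hom_mult[OF mult(1) y] I.I_r_closed[OF mult(1) carr(2)] show ?case by blast
  next
    case (add s t)
    then obtain a y b z where ab: "a \<in> I" "b \<in> I" "y \<in> completion.ext (\<mm> \<cdot> I)" "z \<in> completion.ext (\<mm> \<cdot> I)"
      "s = \<phi> a \<oplus>\<^bsub>C\<^esub> y" "t = \<phi> b \<oplus>\<^bsub>C\<^esub> z" by blast
    then have "a \<in> carrier R" "b \<in> carrier R" "y \<in> carrier C" "z \<in> carrier C" by simp_all
    then have "s \<oplus>\<^bsub>C\<^esub> t = \<phi> (a \<oplus> b) \<oplus>\<^bsub>C\<^esub> (y \<oplus>\<^bsub>C\<^esub> z)"
      unfolding ab(5,6) by (simp add: completion.S.a_ac)
    with ab show ?case by blast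
  qed
  with that show thesis by blast
qed

text \<open>The intersection is over a nonempty family, since \<open>g\<close> lies in the extension
  of \<open>R\<close> itself.\<close>

lemma content_ideal:
  assumes "g \<in> carrier C"
  shows "ideal (content R (restrict_scalars C \<phi>) g) R"
proof -
  have "g \<in> completion.ext (carrier R)"
    using completion.ext_mult[OF one_closed assms] assms by simp
  then show ?thesis unfolding content_def by (intro i_Intersect) (use oneideal in auto)
qed

lemma ohm_rush_imp_principal:
  assumes "ohm_rush_hom R C \<phi>" "g \<in> carrier C"
  shows "\<exists>r \<in> carrier R. PIdl\<^bsub>C\<^esub> g = PIdl\<^bsub>C\<^esub> (\<phi> r)"
proof -
  define I where "I = content R (restrict_scalars C \<phi>) g"
  have I: "ideal I R" unfolding I_def by (rule content_ideal[OF assms(2)])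
  interpret I: ideal I R by (rule I)
  have gI: "g \<in> completion.ext I"
    using assms unfolding ohm_rush_hom_def ohm_rush_def I_def by simp
  have least: "I \<subseteq> J" if "ideal J R" "g \<in> completion.ext J" for J
    using that unfolding I_def content_def by blast
  obtain a y where a: "a \<in> I" "y \<in> completion.ext (\<mm> \<cdot> I)" "g = \<phi> a \<oplus>\<^bsub>C\<^esub> y"
    using ext_modulo_mm[OF I gI] .
  have ac: "a \<in> carrier R" using a(1) by simp
  have aI: "ideal (PIdl a) R" by (rule cgenideal_ideal[OF ac])
  have mI: "ideal (\<mm> \<cdot> I) R" by (rule ideal_prod_is_ideal[OF mm_ideal I])
  have "g \<in> completion.ext (PIdl a <+>\<^bsub>R\<^esub> (\<mm> \<cdot> I))"
  proof -
    have "\<phi> a \<in> completion.ext (PIdl a <+>\<^bsub>R\<^esub> (\<mm> \<cdot> I))"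
      using ideal_subset_set_add(1)[OF aI mI] cgenideal_self[OF ac] ac by (intro completion.hom_in_ext) auto
    moreover have "y \<in> completion.ext (PIdl a <+>\<^bsub>R\<^esub> (\<mm> \<cdot> I))"
      using completion.ext_mono[OF ideal_subset_set_add(2)[OF aI mI]] a(2) by blast
    ultimately show ?thesis unfolding a(3) by (rule completion.ext_add)
  qed
  then have "I \<subseteq> PIdl a <+>\<^bsub>R\<^esub> (\<mm> \<cdot> I)" by (rule least[OF add_ideals[OF aI mI]])
  then have Ia: "I \<subseteq> PIdl a" by (rule nakayama_principal[OF I ac])
  with gI have "g \<in> PIdl\<^bsub>C\<^esub> (\<phi> a)"
    using completion.ext_mono completion.ext_PIdl[OF ac] by blast
  then obtain s where s: "s \<in> carrier C" "g = \<phi> a \<otimes>\<^bsub>C\<^esub> s"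
    using ac by (auto simp: cgenideal_def completion.S.m_comm)
  have "PIdl\<^bsub>C\<^esub> g = PIdl\<^bsub>C\<^esub> (\<phi> a)"
  proof (cases "s \<in> completion.ext \<mm>")
    case False
    then have "s \<in> Units C" by (rule unit_outside_ext_mm[OF s(1)])
    with completion.S.PIdl_mult_unit ac s(2) show ?thesis by simp
  next
    case True
    interpret E: ideal "completion.ext (\<mm> \<cdot> (PIdl a))" C
      by (intro completion.ext_ideal ideal_prod_is_ideal mm_ideal aI)
    have "g \<in> completion.ext (\<mm> \<cdot> (PIdl a))"
      unfolding s(2) using True
    proof (induction rule: completion.ext_induct)
      case (mult e t)
      have "e \<in> carrier R" using mult(1) by simp
      then have "\<phi> a \<otimes>\<^bsub>C\<^esub> (\<phi> e \<otimes>\<^bsub>C\<^esub> t) = \<phi> (e \<otimes> a) \<otimes>\<^bsub>C\<^esub> t"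
        using mult(2) ac by (simp add: completion.S.m_ac)
      with mult cgenideal_self[OF ac] show ?case
        by (simp only:) (intro completion.ext_mult ideal_prod.prod)
    next
      case (add t u)
      interpret M: ideal "completion.ext \<mm>" C by (rule completion.ext_ideal[OF mm_ideal])
      from add ac show ?case by (simp add: completion.S.r_distr)
    qed
    then have "I \<subseteq> \<mm> \<cdot> (PIdl a)" by (intro least ideal_prod_is_ideal mm_ideal aI)
    with a(1) obtain e where e: "e \<in> \<mm>" "a = e \<otimes> a"
      using mem_ideal_prod_PIdl[OF mm_ideal ac] by blast
    have "a = \<zero>"
    proof -
      have u: "\<one> \<ominus> e \<in> Units R" by (rule one_minus_unit[OF e(1)])
      have "(\<one> \<ominus> e) \<otimes> a = a \<ominus> e \<otimes> a"
        using e(1)[THEN \<mm>.Icarr] ac by algebra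
      then have "(\<one> \<ominus> e) \<otimes> a = \<zero>" using e(2) ac by (simp add: minus_eq r_neg)
      then have "(\<one> \<ominus> e) \<otimes> a = (\<one> \<ominus> e) \<otimes> \<zero>" using r_null[OF Units_closed[OF u]] by simp
      with Units_l_cancel[OF u ac zero_closed] show ?thesis by blast
    qed
    with s show ?thesis by simp
  qed
  with ac show ?thesis by blast
qed

lemma extended_imp_principal:
  assumes "\<And>J. ideal J C \<Longrightarrow> extended_ideal R C \<phi> J" "g \<in> carrier C"
  shows "\<exists>r \<in> carrier R. PIdl\<^bsub>C\<^esub> g = PIdl\<^bsub>C\<^esub> (\<phi> r)"
proof -
  have g: "ideal (PIdl\<^bsub>C\<^esub> g) C" by (rule completion.S.cgenideal_ideal[OF assms(2)])
  then obtain I where I: "ideal I R" "PIdl\<^bsub>C\<^esub> g = completion.ext I"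
    using assms(1) unfolding extended_ideal_def by blast
  interpret I: ideal I R by (rule I(1))
  have M: "ideal (completion.ext \<mm>) C" by (rule completion.ext_ideal[OF mm_ideal])
  let ?gM = "completion.ext \<mm> \<cdot>\<^bsub>C\<^esub> (PIdl\<^bsub>C\<^esub> g)"
  have gM: "ideal ?gM C" by (rule completion.S.ideal_prod_is_ideal[OF M g])
  show ?thesis
  \<comment> \<open>The question is whether all of \<open>I\<close> maps into \<open>?gM\<close>. If
    it does, \<open>g\<close> lies in \<open>?gM\<close> as well, which forces \<open>g = 0\<close>;
    if not, some \<open>\<phi> a = s g\<close> has \<open>s\<close> outside
    \<open>completion.ext \<mm>\<close>, hence a unit.\<close>
  proof (cases "\<forall>a \<in> I. \<phi> a \<in> ?gM")
    case True
    then have "completion.ext I \<subseteq> ?gM" by (intro completion.ext_least gM) auto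
    then have "g \<in> ?gM" using completion.S.cgenideal_self[OF assms(2)] I(2) by auto
    then obtain e where e: "e \<in> completion.ext \<mm>" "g = e \<otimes>\<^bsub>C\<^esub> g"
      using completion.S.mem_ideal_prod_PIdl[OF M assms(2)] by blast
    have ec: "e \<in> carrier C" using ideal.Icarr[OF M e(1)] .
    have u: "\<one>\<^bsub>C\<^esub> \<ominus>\<^bsub>C\<^esub> e \<in> Units C" by (rule one_minus_unit_completion[OF e(1)])
    have "(\<one>\<^bsub>C\<^esub> \<ominus>\<^bsub>C\<^esub> e) \<otimes>\<^bsub>C\<^esub> g = g \<ominus>\<^bsub>C\<^esub> e \<otimes>\<^bsub>C\<^esub> g"
      using ec assms(2) by (simp add: completion.S.minus_eq completion.S.l_distr completion.S.l_minus)
    then have "(\<one>\<^bsub>C\<^esub> \<ominus>\<^bsub>C\<^esub> e) \<otimes>\<^bsub>C\<^esub> g = \<zero>\<^bsub>C\<^esub>"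
      using e(2) assms(2) by (simp add: completion.S.minus_eq completion.S.r_neg)
    then have "(\<one>\<^bsub>C\<^esub> \<ominus>\<^bsub>C\<^esub> e) \<otimes>\<^bsub>C\<^esub> g = (\<one>\<^bsub>C\<^esub> \<ominus>\<^bsub>C\<^esub> e) \<otimes>\<^bsub>C\<^esub> \<zero>\<^bsub>C\<^esub>"
      using completion.S.r_null[OF completion.S.Units_closed[OF u]] by simp
    then have "g = \<zero>\<^bsub>C\<^esub>" using completion.S.Units_l_cancel[OF u assms(2)] by blast
    then show ?thesis by (intro bexI[of _ \<zero>]) simp_all
  next
    case False
    then obtain a where a: "a \<in> I" "\<phi> a \<notin> ?gM" by blast
    then have "\<phi> a \<in> PIdl\<^bsub>C\<^esub> g" using I(2) completion.hom_in_ext by simp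
    then obtain s where s: "s \<in> carrier C" "\<phi> a = s \<otimes>\<^bsub>C\<^esub> g" by (auto simp: cgenideal_def)
    with a(2) have "s \<notin> completion.ext \<mm>"
      using ideal_prod.prod[of s "completion.ext \<mm>" g "PIdl\<^bsub>C\<^esub> g" C] completion.S.cgenideal_self[OF assms(2)]
      by auto
    then have "s \<in> Units C" by (rule unit_outside_ext_mm[OF s(1)])
    then have "PIdl\<^bsub>C\<^esub> (\<phi> a) = PIdl\<^bsub>C\<^esub> g"
      using completion.S.PIdl_mult_unit[OF assms(2)] s assms(2) by (simp add: completion.S.m_comm)
    with a(1) show ?thesis by auto
  qed
qed

text \<open>Contraction always holds by \<open>completion_contraction\<close>; condition (3)
  supplies the other axiom of the locale.\<close>

lemma principal_imp_principally_extended: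
  assumes "\<forall>g \<in> carrier C. \<exists>r \<in> carrier R. PIdl\<^bsub>C\<^esub> g = PIdl\<^bsub>C\<^esub> (\<phi> r)"
  shows "principally_extended R C \<phi>"
  by (intro principally_extended.intro completion.ring_hom_cring_axioms principally_extended_axioms.intro)
    (use assms completion_contraction in auto)

end

theorem theorem2p4:
  fixes R :: "('a, 'r) ring_scheme" and \<mm> :: "'a set"
  assumes "noetherian_local_ring R \<mm>"
  shows
    "(ohm_rush_hom R (completion R \<mm>) (completion_map R \<mm>) \<longleftrightarrow>
        gaussian TYPE('c) R (completion R \<mm>) (completion_map R \<mm>)) \<and>
     (ohm_rush_hom R (completion R \<mm>) (completion_map R \<mm>) \<longleftrightarrow>
        (\<forall>g \<in> carrier (completion R \<mm>). \<exists>r \<in> carrier R.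
           PIdl\<^bsub>completion R \<mm>\<^esub> g = PIdl\<^bsub>completion R \<mm>\<^esub> (completion_map R \<mm> r))) \<and>
     (ohm_rush_hom R (completion R \<mm>) (completion_map R \<mm>) \<longleftrightarrow>
        (\<forall>J. ideal J (completion R \<mm>) \<longrightarrow>
           extended_ideal R (completion R \<mm>) (completion_map R \<mm>) J))"
proof -
  interpret noetherian_local R \<mm>
    using assms unfolding noetherian_local_ring_def
    by (intro noetherian_local.intro noetherian_local_axioms.intro) auto
  let ?principal = "\<forall>g \<in> carrier C. \<exists>r \<in> carrier R. PIdl\<^bsub>C\<^esub> g = PIdl\<^bsub>C\<^esub> (\<phi> r)"
  \<comment> \<open>All conditions are compared with (3): it implies the others through the locale
    \<open>principally_extended\<close>, (1) and (4) each imply it, and (2) contains (1) by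
    definition.\<close>
  have "ohm_rush_hom R C \<phi> \<longleftrightarrow> ?principal"
    using ohm_rush_imp_principal principally_extended.is_ohm_rush[OF principal_imp_principally_extended] by blast
  moreover have "(\<forall>J. ideal J C \<longrightarrow> extended_ideal R C \<phi> J) \<longleftrightarrow> ?principal"
    using extended_imp_principal principally_extended.ideal_extended[OF principal_imp_principally_extended] by blast
  moreover have "gaussian TYPE('c) R C \<phi>" if ?principal
    by (rule principally_extended.is_gaussian[OF principal_imp_principally_extended[OF that]])
  moreover have "ohm_rush_hom R C \<phi>" if "gaussian TYPE('c) R C \<phi>"
    using that unfolding gaussian_def by blast
  ultimately show ?thesis by blast
qed

end
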